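(* Let $K$ be a field, let $n\ge 1$, and let $S=K[x_1,\ldots,x_n]$ with its standard $\mathbb Z^n$-grading. Let $M$ be a nonzero finitely generated $\mathbb Z^n$-graded $S$-module. If $\operatorname{sdepth}(M)=0$, then $\operatorname{depth}(M)=0$. Conversely, if $\operatorname{depth}(M)=0$ and $\dim_K(M_a)\le 1$ for every $a\in\mathbb Z^n$, then $\operatorname{sdepth}(M)=0$.
   Context: The standard $\mathbb Z^n$-grading on $S$ is the one in which $x_i$ has degree the $i$-th standard basis vector of $\mathbb Z^n$; $M_a$ denotes the component of $M$ of degree $a\in\mathbb Z^n$. The depth of $M$ is taken with respect to the ideal $(x_1,\ldots,x_n)$. A Stanley decomposition of a nonzero finitely generated $\mathbb Z^n$-graded $S$-module $M$ is a finite direct sum decomposition $\mathcal D:\ M=\bigoplus_{i=1}^r m_iK[Z_i]$ as a $K$-vector space, where each $m_i\in M$ is homogeneous, $Z_i\subset\{x_1,\ldots,x_n\}$ is a subset (possibly empty), $m_iK[Z_i]$ is the $K[Z_i]$-submodule of $M$ generated by $m_i$, and $m_iK[Z_i]$ is a free $K[Z_i]$-module of rank one (i.e. $m_i$ is not annihilated by any nonzero element of $K[Z_i]$). Put $\operatorname{sdepth}(\mathcal D)=\min_{1\le i\le r}|Z_i|$. The Stanley depth of $M$ is $\operatorname{sdepth}(M)=\max\{\operatorname{sdepth}(\mathcal D)\}$, the maximum over all Stanley decompositions $\mathcal D$ of $M$. *)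

theory Defs
  imports Complex_Main "HOL-Library.Poly_Mapping" "HOL-Library.Extended_Nat"
begin

section \<open>Regular sequences and depth\<close>

text \<open>The submodule \<open>(f\<^sub>1, \<dots>, f\<^sub>r) M\<close>.\<close>

definition mult_submodule ::
    "('a::comm_ring_1 \<Rightarrow> 'b::ab_group_add \<Rightarrow> 'b) \<Rightarrow> 'a list \<Rightarrow> 'b set" where
  "mult_submodule scale fs = module.span scale {scale f x | f x. f \<in> set fs}"

text \<open>\<open>f\<^sub>i\<close> is a nonzerodivisor on \<open>M / (f\<^sub>1, \<dots>, f\<^sub>i\<^sub>-\<^sub>1) M\<close> for all \<open>i\<close>, and
  \<open>(f\<^sub>1, \<dots>, f\<^sub>r) M \<noteq> M\<close>.\<close>

definition regular_sequence ::
    "('a::comm_ring_1 \<Rightarrow> 'b::ab_group_add \<Rightarrow> 'b) \<Rightarrow> 'a list \<Rightarrow> bool" where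
  "regular_sequence scale fs \<longleftrightarrow>
     (\<forall>i<length fs. \<forall>x. scale (fs ! i) x \<in> mult_submodule scale (take i fs) \<longrightarrow>
                        x \<in> mult_submodule scale (take i fs)) \<and>
     mult_submodule scale fs \<noteq> UNIV"

definition depth :: "('a::comm_ring_1 \<Rightarrow> 'b::ab_group_add \<Rightarrow> 'b) \<Rightarrow> 'a set \<Rightarrow> enat" where
  "depth scale I = (SUP fs \<in> {fs. set fs \<subseteq> I \<and> regular_sequence scale fs}. enat (length fs))"

definition finitely_generated ::
    "('a::comm_ring_1 \<Rightarrow> 'b::ab_group_add \<Rightarrow> 'b) \<Rightarrow> bool" where
  "finitely_generated scale \<longleftrightarrow> (\<exists>B. finite B \<and> module.span scale B = UNIV)"


section \<open>The polynomial ring\<close>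

text \<open>The variables are indexed by a finite (hence nonempty) type \<open>'n\<close>, so that
  \<open>n = CARD('n) \<ge> 1\<close>; exponent vectors are elements of \<open>'n \<Rightarrow>\<^sub>0 nat\<close>, and \<open>\<int>\<^sup>n\<close> is
  \<open>'n \<Rightarrow> int\<close>.\<close>

type_synonym ('k, 'n) polyring = "('n \<Rightarrow>\<^sub>0 nat) \<Rightarrow>\<^sub>0 'k"

definition Const :: "'k::field \<Rightarrow> ('k, 'n::finite) polyring" where
  "Const c = Poly_Mapping.single 0 c"

definition Var :: "'n::finite \<Rightarrow> ('k::field, 'n) polyring" where
  "Var i = Poly_Mapping.single (Poly_Mapping.single i 1) 1"

definition irrelevant_ideal :: "('k::field, 'n::finite) polyring set" where
  "irrelevant_ideal = module.span (*) (range Var)"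

text \<open>The subring \<open>K[Z]\<close>.\<close>

definition polys_in :: "'n::finite set \<Rightarrow> ('k::field, 'n) polyring set" where
  "polys_in Z = {p. \<forall>u \<in> Poly_Mapping.keys p. Poly_Mapping.keys u \<subseteq> Z}"


section \<open>Multigraded modules and Stanley decompositions\<close>

text \<open>For additive subgroups \<open>V i\<close>, the following says that the whole type is the internal
  direct sum of the \<open>V i\<close> with \<open>i \<in> I\<close>.\<close>

definition direct_sum :: "'i set \<Rightarrow> ('i \<Rightarrow> 'm::ab_group_add set) \<Rightarrow> bool" where
  "direct_sum I V \<longleftrightarrow>
     (\<forall>x. \<exists>!f :: 'i \<Rightarrow>\<^sub>0 'm. Poly_Mapping.keys f \<subseteq> I \<and> (\<forall>i\<in>I. Poly_Mapping.lookup f i \<in> V i) \<and>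
                           x = (\<Sum>i\<in>Poly_Mapping.keys f. Poly_Mapping.lookup f i))"

text \<open>In \<open>monomial_scale_closed\<close>, the case \<open>u = 0\<close> says that the components are closed under
  multiplication by scalars of \<open>K\<close>.\<close>

locale multigraded_module = module scale
  for scale :: "('k::field, 'n::finite) polyring \<Rightarrow> 'm::ab_group_add \<Rightarrow> 'm" +
  fixes comp :: "('n \<Rightarrow> int) \<Rightarrow> 'm set"
  assumes zero_closed: "0 \<in> comp a"
    and add_closed: "x \<in> comp a \<Longrightarrow> y \<in> comp a \<Longrightarrow> x + y \<in> comp a"
    and monomial_scale_closed:
      "x \<in> comp a \<Longrightarrow>
        scale (Poly_Mapping.single u c) x \<in> comp (\<lambda>i. a i + int (Poly_Mapping.lookup u i))"
    and direct_sum_comp: "direct_sum UNIV comp"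
begin

definition scaleK :: "'k \<Rightarrow> 'm \<Rightarrow> 'm" where
  "scaleK c x = scale (Const c) x"

lemma vector_space_scaleK: "vector_space scaleK"
proof
  fix a b :: 'k and x y :: 'm
  show "scaleK a (x + y) = scaleK a x + scaleK a y"
    by (simp add: scaleK_def scale_right_distrib)
  show "scaleK (a + b) x = scaleK a x + scaleK b x"
    by (simp add: scaleK_def Const_def single_add scale_left_distrib)
  show "scaleK a (scaleK b x) = scaleK (a * b) x"
    by (simp add: scaleK_def Const_def mult_single)
  show "scaleK 1 x = x"
    by (simp add: scaleK_def Const_def)
qed

text \<open>\<open>vector_space.dim\<close> is \<open>0\<close> on infinite-dimensional spaces; this case does not occur when
  \<open>M\<close> is finitely generated.\<close>

definition dim_comp :: "('n \<Rightarrow> int) \<Rightarrow> nat" where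
  "dim_comp a = vector_space.dim scaleK (comp a)"

definition homogeneous :: "'m \<Rightarrow> bool" where
  "homogeneous x \<longleftrightarrow> (\<exists>a. x \<in> comp a)"

definition stanley_space :: "'m \<times> 'n set \<Rightarrow> 'm set" where
  "stanley_space = (\<lambda>(x, Z). {scale p x | p. p \<in> polys_in Z})"

definition stanley_decomposition :: "('m \<times> 'n set) list \<Rightarrow> bool" where
  "stanley_decomposition D \<longleftrightarrow>
     (\<forall>(x, Z) \<in> set D. homogeneous x \<and> (\<forall>p \<in> polys_in Z. p \<noteq> 0 \<longrightarrow> scale p x \<noteq> 0)) \<and>
     direct_sum {..<length D} (\<lambda>i. stanley_space (D ! i))"

definition sdepth_of :: "('m \<times> 'n set) list \<Rightarrow> nat" where
  "sdepth_of D = Min ((\<lambda>(x, Z). card Z) ` set D)"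

text \<open>For \<open>M \<noteq> 0\<close>, every decomposition is a nonempty list, so its minimum is at most \<open>n\<close>
  and the set below is finite.\<close>

definition sdepth :: nat where
  "sdepth = Max {sdepth_of D | D. stanley_decomposition D}"

end

end

(*  If no nonzero element is annihilated by all variables, filter M by the submodules N_J of
    elements killed by a power of x_j for every j in J.  The variable x_i is regular on N_J modulo
    N_{J + i}, which yields Stanley spaces m K[Z] with i in Z for this layer of the filtration, and
    the last layer N_{1..n} vanishes.  In general the last layer is a finite-dimensional vector
    space, which contributes the spaces with Z empty.  That finitely many spaces suffice follows
    because the multiplications between the components M_a are isomorphisms once the increased
    coordinates are large enough.

    Depth zero is detected by the single element f = x_1 + ... + x_n: if f y = 0, then every
    homogeneous component of y is killed by a power of each variable, so M has a nonzero
    homogeneous socle element.  If dim M_a <= 1, a socle element in degree a is, up to a scalar,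
    a monomial multiple of the generator of one Stanley space m K[Z]; freeness over K[Z] then
    forces Z to be empty. *)

theory Submission
  imports Defs "HOL-Library.FuncSet"
begin

text \<open>The obstacle is that positive depth need not make any single variable regular: on
  K[x,y]/(xy) both variables are zero divisors, while x + y is regular. Hence a filtration in which
  each layer has a variable of its own. The form f works over every field, finite ones included,
  because the associated primes of a Z^n-graded module are generated by sets of variables, and such
  a prime contains x_1 + ... + x_n only if it contains every variable; the proof replaces this by an
  argument on leading terms. Of the isomorphisms in high degrees, surjectivity is visible from the
  degrees of finitely many generators. Injectivity concerns the relations; it comes from dimensions,
  since a surjection with a kernel lowers them. After that only vector spaces indexed by Z^n and
  linear maps between them remain, and Stanley spaces are built and compared one degree at a
  time.\<close>

section \<open>Bases relative to a subspace\<close>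

text \<open>A copy of \<^locale>\<open>vector_space\<close>: a constant defined in that locale itself would be
  shadowed by its instance for the interpretation by real vector spaces.\<close>

locale linear_space = vector_space scale
  for scale :: "'a::field \<Rightarrow> 'b::ab_group_add \<Rightarrow> 'b"
begin

text \<open>For subspaces \<open>U \<subseteq> W\<close> this is a basis of the quotient W/U. It is
  an indexed family because later the same index, a Stanley space, stands for a different vector in
  each degree.\<close>

definition relative_basis :: "'i set \<Rightarrow> ('i \<Rightarrow> 'b) \<Rightarrow> 'b set \<Rightarrow> 'b set \<Rightarrow> bool" where
  "relative_basis I f U W \<longleftrightarrow> finite I \<and> f ` I \<subseteq> W \<and>
     (\<forall>r. (\<Sum>i\<in>I. scale (r i) (f i)) \<in> U \<longrightarrow> (\<forall>i\<in>I. r i = 0)) \<and>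
     (\<forall>w\<in>W. \<exists>r. w - (\<Sum>i\<in>I. scale (r i) (f i)) \<in> U)"

lemma relative_basisI:
  assumes "finite I" "\<And>i. i \<in> I \<Longrightarrow> f i \<in> W"
    and "\<And>r i. (\<Sum>i\<in>I. scale (r i) (f i)) \<in> U \<Longrightarrow> i \<in> I \<Longrightarrow> r i = 0"
    and "\<And>w. w \<in> W \<Longrightarrow> \<exists>r. w - (\<Sum>i\<in>I. scale (r i) (f i)) \<in> U"
  shows "relative_basis I f U W"
  using assms unfolding relative_basis_def by blast

lemma
  assumes "relative_basis I f U W"
  shows relative_basis_finite: "finite I"
    and relative_basis_in: "i \<in> I \<Longrightarrow> f i \<in> W"
    and relative_basis_independent: "(\<Sum>i\<in>I. scale (r i) (f i)) \<in> U \<Longrightarrow> i \<in> I \<Longrightarrow> r i = 0"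
    and relative_basis_spans: "w \<in> W \<Longrightarrow> \<exists>r. w - (\<Sum>i\<in>I. scale (r i) (f i)) \<in> U"
  using assms unfolding relative_basis_def by blast+

lemma relative_basis_empty: "subspace U \<Longrightarrow> relative_basis {} f U U"
  by (rule relative_basisI) auto

lemma relative_basis_notin:
  assumes "relative_basis I f U W" "i \<in> I"
  shows "f i \<notin> U"
proof
  assume "f i \<in> U"
  moreover have "(\<Sum>j\<in>I. scale (if j = i then 1 else 0) (f j)) = (\<Sum>j\<in>I. if j = i then f j else 0)"
    by (intro sum.cong) auto
  then have "(\<Sum>j\<in>I. scale (if j = i then 1 else 0) (f j)) = f i"
    using assms(2) relative_basis_finite[OF assms(1)] by (simp add: sum.delta)
  ultimately show False
    using relative_basis_independent[OF assms(1), of "\<lambda>j. if j = i then 1 else 0" i] assms(2) by simp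
qed

lemma relative_basis_reindex:
  assumes "relative_basis I f U W" "inj_on g I" "\<And>i. i \<in> I \<Longrightarrow> f' (g i) = f i"
  shows "relative_basis (g ` I) f' U W"
proof (rule relative_basisI)
  show "finite (g ` I)" using relative_basis_finite[OF assms(1)] by simp
  show "f' i \<in> W" if "i \<in> g ` I" for i
    using that assms(3) relative_basis_in[OF assms(1)] by auto
  have sum: "(\<Sum>i\<in>g ` I. scale (r i) (f' i)) = (\<Sum>i\<in>I. scale (r (g i)) (f i))" for r
    by (subst sum.reindex[OF assms(2)]) (simp add: assms(3))
  show "r i = 0" if "(\<Sum>i\<in>g ` I. scale (r i) (f' i)) \<in> U" "i \<in> g ` I" for r i
    using relative_basis_independent[OF assms(1), of "\<lambda>i. r (g i)"] that unfolding sum by auto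
  show "\<exists>r. w - (\<Sum>i\<in>g ` I. scale (r i) (f' i)) \<in> U" if w: "w \<in> W" for w
  proof -
    obtain r where r: "w - (\<Sum>i\<in>I. scale (r i) (f i)) \<in> U"
      using relative_basis_spans[OF assms(1) w] by blast
    have "(\<Sum>i\<in>I. scale (r (the_inv_into I g (g i))) (f i)) = (\<Sum>i\<in>I. scale (r i) (f i))"
      by (intro sum.cong) (auto simp: the_inv_into_f_f[OF assms(2)])
    then show ?thesis
      using r by (intro exI[of _ "\<lambda>i. r (the_inv_into I g i)"]) (simp add: sum)
  qed
qed

lemma relative_basis_Un:
  assumes I: "relative_basis I f U W" and J: "relative_basis J f W X"
    and W: "subspace W" "U \<subseteq> W" "W \<subseteq> X"
  shows "relative_basis (I \<union> J) f U X"
proof (rule relative_basisI)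
  note fin = relative_basis_finite[OF I] relative_basis_finite[OF J]
  then show "finite (I \<union> J)" by simp
  \<comment> \<open>The vector of a common index would lie in \<open>W\<close>, but on
    \<open>J\<close> the vectors are nonzero modulo \<open>W\<close>.\<close>
  have disj: "I \<inter> J = {}"
    using relative_basis_in[OF I] relative_basis_notin[OF J] by blast
  show "f i \<in> X" if "i \<in> I \<union> J" for i
    using that relative_basis_in[OF I] relative_basis_in[OF J] W by blast
  have inW: "(\<Sum>i\<in>I. scale (r i) (f i)) \<in> W" for r
    using W(1) relative_basis_in[OF I] by (intro subspace_sum subspace_scale) auto
  have split: "(\<Sum>i\<in>I \<union> J. scale (r i) (f i)) = (\<Sum>i\<in>I. scale (r i) (f i)) + (\<Sum>i\<in>J. scale (r i) (f i))" for r
    using fin disj by (rule sum.union_disjoint)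
  show "r i = 0" if r: "(\<Sum>i\<in>I \<union> J. scale (r i) (f i)) \<in> U" and i: "i \<in> I \<union> J" for r i
  proof -
    have "(\<Sum>i\<in>J. scale (r i) (f i)) = (\<Sum>i\<in>I \<union> J. scale (r i) (f i)) - (\<Sum>i\<in>I. scale (r i) (f i))"
      by (simp add: split)
    also have "\<dots> \<in> W" using r W inW by (intro subspace_diff) auto
    finally have rJ: "\<forall>j\<in>J. r j = 0" using relative_basis_independent[OF J] by blast
    then have "(\<Sum>i\<in>J. scale (r i) (f i)) = 0" by (intro sum.neutral) simp
    then have "(\<Sum>i\<in>I. scale (r i) (f i)) \<in> U" using r by (simp add: split)
    then have "\<forall>j\<in>I. r j = 0" using relative_basis_independent[OF I] by blast
    then show ?thesis using rJ i by blast
  qed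
  show "\<exists>r. w - (\<Sum>i\<in>I \<union> J. scale (r i) (f i)) \<in> U" if w: "w \<in> X" for w
  proof -
    obtain r where "w - (\<Sum>i\<in>J. scale (r i) (f i)) \<in> W"
      using relative_basis_spans[OF J w] by blast
    then obtain q where q: "w - (\<Sum>i\<in>J. scale (r i) (f i)) - (\<Sum>i\<in>I. scale (q i) (f i)) \<in> U"
      using relative_basis_spans[OF I] by blast
    define p where "p = (\<lambda>i. if i \<in> I then q i else r i)"
    have "(\<Sum>i\<in>I. scale (p i) (f i)) = (\<Sum>i\<in>I. scale (q i) (f i))"
      by (intro sum.cong) (auto simp: p_def)
    moreover have "(\<Sum>i\<in>J. scale (p i) (f i)) = (\<Sum>i\<in>J. scale (r i) (f i))"
      using disj by (intro sum.cong) (auto simp: p_def)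
    ultimately have "w - (\<Sum>i\<in>I \<union> J. scale (p i) (f i)) \<in> U"
      using q by (simp add: split algebra_simps)
    then show ?thesis by blast
  qed
qed

text \<open>By \<open>iff\<close> and \<open>surj\<close> the map \<open>T\<close> induces an
  isomorphism from W/U to W'/U', and isomorphisms carry bases to bases.\<close>

lemma relative_basis_image:
  assumes I: "relative_basis I f U W" and W: "subspace W" "subspace U'"
    and T: "\<And>x y. T (x + y) = T x + T y" "\<And>k x. T (scale k x) = scale k (T x)"
    and in': "\<And>w. w \<in> W \<Longrightarrow> T w \<in> W'"
    and iff: "\<And>w. w \<in> W \<Longrightarrow> T w \<in> U' \<longleftrightarrow> w \<in> U"
    and surj: "\<And>w'. w' \<in> W' \<Longrightarrow> \<exists>w\<in>W. w' - T w \<in> U'"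
    and UW: "U \<subseteq> W"
  shows "relative_basis I (\<lambda>i. T (f i)) U' W'"
proof (rule relative_basisI)
  show "finite I" using I by (rule relative_basis_finite)
  show "T (f i) \<in> W'" if "i \<in> I" for i using that in' relative_basis_in[OF I] by blast
  have T0: "T 0 = 0" using T(2)[of 0 0] by simp
  have sum: "(\<Sum>i\<in>I. scale (r i) (T (f i))) = T (\<Sum>i\<in>I. scale (r i) (f i))" for r
    using \<open>finite I\<close> by (induction I rule: finite_induct) (auto simp: T T0)
  have inW: "(\<Sum>i\<in>I. scale (r i) (f i)) \<in> W" for r
    using W(1) relative_basis_in[OF I] by (intro subspace_sum subspace_scale) auto
  show "r i = 0" if "(\<Sum>i\<in>I. scale (r i) (T (f i))) \<in> U'" "i \<in> I" for r i
    using that relative_basis_independent[OF I] iff[OF inW] unfolding sum by blast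
  show "\<exists>r. w' - (\<Sum>i\<in>I. scale (r i) (T (f i))) \<in> U'" if w': "w' \<in> W'" for w'
  proof -
    obtain w where w: "w \<in> W" "w' - T w \<in> U'" using surj[OF w'] by blast
    obtain r where r: "w - (\<Sum>i\<in>I. scale (r i) (f i)) \<in> U"
      using relative_basis_spans[OF I w(1)] by blast
    let ?s = "\<Sum>i\<in>I. scale (r i) (f i)"
    have "T (w - ?s) \<in> U'" using iff r UW by blast
    then have "(w' - T w) + T (w - ?s) \<in> U'" using w(2) W(2) by (intro subspace_add)
    moreover have "T w = T (w - ?s) + T ?s" by (simp flip: T(1))
    ultimately show ?thesis by (intro exI[of _ r]) (simp add: sum)
  qed
qed

text \<open>Extend a basis of \<open>U\<close> to a basis of \<open>W\<close> and keep the added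
  vectors.\<close>

lemma relative_basis_exists:
  assumes U: "subspace U" "U \<subseteq> W" and W: "subspace W" "finite B" "W \<subseteq> span B"
  shows "\<exists>C. relative_basis C id U W"
proof -
  obtain B1 where B1: "B1 \<subseteq> U" "independent B1" "U \<subseteq> span B1"
    using basis_exists by metis
  obtain B2 where B2: "B1 \<subseteq> B2" "B2 \<subseteq> W" "independent B2" "W \<subseteq> span B2"
    using maximal_independent_subset_extend[of B1 W] B1 U by blast
  have fin: "finite B2" using independent_span_bound[OF W(2) B2(3)] B2 W by blast
  then have fin1: "finite B1" using B2(1) finite_subset by blast
  have "relative_basis (B2 - B1) id U W"
  proof (rule relative_basisI)
    show "finite (B2 - B1)" using fin by simp
    show "id i \<in> W" if "i \<in> B2 - B1" for i using that B2 by auto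
    show "r b = 0" if r: "(\<Sum>i\<in>B2 - B1. scale (r i) (id i)) \<in> U" and b: "b \<in> B2 - B1" for r b
    proof -
      have "(\<Sum>i\<in>B2 - B1. scale (r i) i) \<in> span B1" using r B1 by auto
      then obtain q where q: "(\<Sum>i\<in>B2 - B1. scale (r i) i) = (\<Sum>v\<in>B1. scale (q v) v)"
        using fin1 by (auto simp: span_finite)
      define p where "p = (\<lambda>v. if v \<in> B1 then - q v else r v)"
      have "(\<Sum>v\<in>B2. scale (p v) v) = (\<Sum>v\<in>B1. scale (p v) v) + (\<Sum>v\<in>B2 - B1. scale (p v) v)"
        by (subst sum.subset_diff[OF B2(1) fin]) (rule add.commute)
      also have "(\<Sum>v\<in>B1. scale (p v) v) = - (\<Sum>v\<in>B1. scale (q v) v)"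
        unfolding sum_negf[symmetric] by (intro sum.cong) (auto simp: p_def)
      also have "(\<Sum>v\<in>B2 - B1. scale (p v) v) = (\<Sum>v\<in>B2 - B1. scale (r v) v)"
        by (intro sum.cong) (auto simp: p_def)
      finally have "(\<Sum>v\<in>B2. scale (p v) v) = 0" by (simp add: q)
      then have "p b = 0" using B2(3) fin b independentD by blast
      then show ?thesis using b by (simp add: p_def)
    qed
    show "\<exists>r. w - (\<Sum>i\<in>B2 - B1. scale (r i) (id i)) \<in> U" if w: "w \<in> W" for w
    proof -
      obtain r where r: "w = (\<Sum>v\<in>B2. scale (r v) v)"
        using subsetD[OF B2(4) w] fin by (auto simp: span_finite)
      have "(\<Sum>v\<in>B2. scale (r v) v) = (\<Sum>v\<in>B1. scale (r v) v) + (\<Sum>v\<in>B2 - B1. scale (r v) v)"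
        by (subst sum.subset_diff[OF B2(1) fin]) (rule add.commute)
      then have "w - (\<Sum>i\<in>B2 - B1. scale (r i) (id i)) = (\<Sum>v\<in>B1. scale (r v) v)"
        by (simp add: r)
      also have "\<dots> \<in> U" using U B1 by (intro subspace_sum subspace_scale) auto
      finally show ?thesis by blast
    qed
  qed
  then show ?thesis by blast
qed

end

section \<open>Monotone subsequences\<close>

lemma mono_subseq_nat:
  fixes g :: "nat \<Rightarrow> nat"
  shows "\<exists>r :: nat \<Rightarrow> nat. strict_mono r \<and> mono (\<lambda>n. g (r n))"
proof -
  obtain f where f: "strict_mono f" "monoseq (\<lambda>n. g (f n))"
    using seq_monosub[of g] by blast
  show ?thesis
  proof (cases "mono (\<lambda>n. g (f n))")
    case False
    then have dec: "\<And>m n. m \<le> n \<Longrightarrow> g (f n) \<le> g (f m)"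
      using f(2) by (auto simp: monoseq_def mono_def)
    \<comment> \<open>A nonincreasing sequence of naturals is constant once it has attained its
      minimum.\<close>
    obtain N where N: "\<And>n. g (f N) \<le> g (f n)"
      using ex_has_least_nat[of "\<lambda>_. True" _ "\<lambda>n. g (f n)"] by auto
    have "g (f (n + N)) = g (f N)" for n
      using N dec by (intro antisym) auto
    moreover have "strict_mono (\<lambda>n. f (n + N))"
      using f(1) by (simp add: strict_mono_def)
    ultimately show ?thesis by (intro exI[of _ "\<lambda>n. f (n + N)"]) (simp add: mono_def)
  qed (use f(1) in blast)
qed

text \<open>Dickson's lemma for sequences: thin out for one member of the family after the other; a
  further subsequence keeps the monotonicity already obtained.\<close>

lemma mono_subseq_family:
  fixes f :: "'s \<Rightarrow> nat \<Rightarrow> int"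
  assumes "finite S" "\<And>s n. s \<in> S \<Longrightarrow> lo \<le> f s n"
  shows "\<exists>r :: nat \<Rightarrow> nat. strict_mono r \<and> (\<forall>s\<in>S. mono (\<lambda>n. f s (r n)))"
  using assms
proof (induction S rule: finite_induct)
  case empty
  show ?case by (intro exI[of _ id]) (simp add: strict_mono_def)
next
  case (insert s S)
  then obtain r :: "nat \<Rightarrow> nat" where r: "strict_mono r" "\<And>s. s \<in> S \<Longrightarrow> mono (\<lambda>n. f s (r n))" by auto
  obtain q :: "nat \<Rightarrow> nat" where q: "strict_mono q" "mono (\<lambda>n. nat (f s (r (q n)) - lo))"
    using mono_subseq_nat[of "\<lambda>n. nat (f s (r n) - lo)"] by blast
  have "mono (\<lambda>n. f s (r (q n)))"
    using q(2) insert.prems[of s] by (fastforce simp: mono_def nat_le_eq_zle)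
  moreover have "mono (\<lambda>n. f t (r (q n)))" if "t \<in> S" for t
    using r(2)[OF that] q(1) by (auto simp: mono_def strict_mono_less_eq)
  moreover have "strict_mono (\<lambda>n. r (q n))"
    using r(1) q(1) by (simp add: strict_mono_def)
  ultimately show ?case by (intro exI[of _ "\<lambda>n. r (q n)"]) auto
qed

section \<open>Persistence modules over the integer lattice\<close>

text \<open>In module terms, x^(c - a) involves only variables in whose coordinate the degree
  \<open>a\<close> is already at least \<open>h\<close>.\<close>

definition stable_le :: "int \<Rightarrow> ('n \<Rightarrow> int) \<Rightarrow> ('n \<Rightarrow> int) \<Rightarrow> bool" where
  "stable_le h a c \<longleftrightarrow> a \<le> c \<and> (\<forall>j. a j < c j \<longrightarrow> h \<le> a j)"

text \<open>\<open>V a\<close> stands for the component M_a and \<open>T a c\<close> for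
  multiplication by x^(c - a). Outside \<open>a \<le> c\<close> the map is an arbitrary linear
  one.\<close>

locale persistence_module = linear_space scale
  for scale :: "'k::field \<Rightarrow> 'm::ab_group_add \<Rightarrow> 'm" +
  fixes V :: "('n::finite \<Rightarrow> int) \<Rightarrow> 'm set"
    and T :: "('n \<Rightarrow> int) \<Rightarrow> ('n \<Rightarrow> int) \<Rightarrow> 'm \<Rightarrow> 'm"
  assumes subspace_V: "subspace (V a)"
    and finite_dim: "\<exists>B. finite B \<and> V a \<subseteq> span B"
    and T_in: "a \<le> c \<Longrightarrow> x \<in> V a \<Longrightarrow> T a c x \<in> V c"
    and T_add: "T a c (x + y) = T a c x + T a c y"
    and T_scale: "T a c (scale k x) = scale k (T a c x)"
    and T_refl: "T a a x = x"
    and T_trans: "a \<le> b \<Longrightarrow> b \<le> c \<Longrightarrow> T b c (T a b x) = T a c x"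
begin

lemma T_zero [simp]: "T a c 0 = 0"
  using T_scale[of a c 0 0] by simp

lemma T_diff: "T a c (x - y) = T a c x - T a c y"
  using T_add[of a c "x - y" y] by simp

lemma T_sum: "T a c (\<Sum>i\<in>I. f i) = (\<Sum>i\<in>I. T a c (f i))"
  by (induction I rule: infinite_finite_induct) (auto simp: T_add)

text \<open>The images of those basis vectors of \<open>V a\<close> that are not killed span
  \<open>V c\<close>. For the strict inequality, start the basis with the given kernel
  vector.\<close>

lemma dim_le_of_surj:
  assumes "V c \<subseteq> T a c ` V a"
  shows "dim (V c) \<le> dim (V a)"
    and "x \<in> V a \<Longrightarrow> x \<noteq> 0 \<Longrightarrow> T a c x = 0 \<Longrightarrow> dim (V c) < dim (V a)"
proof -
  obtain W where W: "finite W" "V a \<subseteq> span W" using finite_dim by blast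
  have *: "dim (V c) \<le> card (B - {b. T a c b = 0}) \<and> card B = dim (V a) \<and> finite B"
    if B: "B \<subseteq> V a" "independent B" "V a \<subseteq> span B" for B
  proof -
    have fin: "finite B" using independent_span_bound[OF W(1) B(2)] B W by blast
    let ?B = "B - {b. T a c b = 0}"
    have "V c \<subseteq> span (T a c ` ?B)"
    proof
      fix w assume "w \<in> V c"
      then obtain v where v: "v \<in> span B" "w = T a c v" using assms B(3) by blast
      then obtain r where "v = (\<Sum>b\<in>B. scale (r b) b)"
        using fin by (auto simp: span_finite)
      then have "w = (\<Sum>b\<in>B. scale (r b) (T a c b))"
        by (simp add: v T_sum T_scale)
      also have "\<dots> = (\<Sum>b\<in>?B. scale (r b) (T a c b))"
        using fin by (intro sum.mono_neutral_right) auto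
      also have "\<dots> \<in> span (T a c ` ?B)"
        by (intro span_sum span_scale span_base) auto
      finally show "w \<in> span (T a c ` ?B)" .
    qed
    then have "dim (V c) \<le> card (T a c ` ?B)" using fin by (intro dim_le_card) auto
    also have "\<dots> \<le> card ?B" using fin by (intro card_image_le) auto
    finally show ?thesis using basis_card_eq_dim[OF B(1) B(3) B(2)] fin by blast
  qed
  obtain B where "B \<subseteq> V a" "independent B" "V a \<subseteq> span B" using basis_exists by metis
  from *[OF this] show "dim (V c) \<le> dim (V a)"
    using card_mono[of B "B - {b. T a c b = 0}"] by auto
  assume x: "x \<in> V a" "x \<noteq> 0" "T a c x = 0"
  then obtain B where B: "{x} \<subseteq> B" "B \<subseteq> V a" "independent B" "V a \<subseteq> span B"
    using maximal_independent_subset_extend[of "{x}" "V a"] by (auto simp: dependent_single)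
  then have "card (B - {b. T a c b = 0}) < card B"
    using *[of B] x(3) by (intro psubset_card_mono) auto
  then show "dim (V c) < dim (V a)" using *[of B] B by auto
qed

text \<open>Along \<^term>\<open>stable_le h0\<close> the dimension is antitone, so an infinite sequence of
  noninjective maps in ever higher degrees would contradict Dickson's lemma.\<close>

lemma eventually_injective:
  assumes below: "\<And>a. V a \<noteq> {0} \<Longrightarrow> \<forall>j. lo \<le> a j"
    and surj: "\<And>a c. stable_le h0 a c \<Longrightarrow> V c \<subseteq> T a c ` V a"
  shows "\<exists>h\<ge>h0. \<forall>a c x. stable_le h a c \<longrightarrow> x \<in> V a \<longrightarrow> T a c x = 0 \<longrightarrow> x = 0"
proof (rule ccontr)
  assume "\<not> ?thesis"
  then have "\<exists>a c x. stable_le (h0 + int k) a c \<and> x \<in> V a \<and> T a c x = 0 \<and> x \<noteq> 0" for k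
    by (metis le_add_same_cancel1 of_nat_0_le_iff)
  then obtain A C X where A: "\<And>k. stable_le (h0 + int k) (A k) (C k)" "\<And>k. X k \<in> V (A k)"
      "\<And>k. T (A k) (C k) (X k) = 0" "\<And>k. X k \<noteq> 0"
    by metis
  have A_le: "A k j \<le> C k j" and A_high: "A k j < C k j \<Longrightarrow> h0 + int k \<le> A k j" for k j
    using A(1)[of k] by (auto simp: stable_le_def le_fun_def)
  have "lo \<le> A k j" for k j using below[of "A k"] A(2,4)[of k] by auto
  then have C_lo: "lo \<le> C k j" for k j using A_le order_trans by blast
  \<comment> \<open>Monotonicity of the first two families together makes
    \<open>min (C k j) h0\<close> constant along the subsequence, so a coordinate that really
    increases starts at \<open>h0\<close> or above. The third keeps the dimensions from
    dropping.\<close>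
  define f :: "'n + 'n + unit \<Rightarrow> nat \<Rightarrow> int" where
    "f = case_sum (\<lambda>j k. C k j) (case_sum (\<lambda>j k. - min (C k j) h0) (\<lambda>_ k. int (dim (V (C k)))))"
  have "min lo (min (- h0) 0) \<le> f s k" for s k
    using C_lo[of k] by (auto simp: f_def min_le_iff_disj split: sum.splits)
  then obtain r :: "nat \<Rightarrow> nat" where r: "strict_mono r" "\<And>s. mono (\<lambda>k. f s (r k))"
    using mono_subseq_family[of UNIV "min lo (min (- h0) 0)" f] by auto
  define g where "g = C (r 0)"
  \<comment> \<open>So far along that \<open>h0 + int n\<close> bounds every coordinate of
    \<open>g\<close>: where \<open>A n\<close> lies below \<open>C n\<close> it is at least
    \<open>h0 + int n\<close>, and elsewhere it equals \<open>C n\<close>. Hence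
    \<open>g \<le> A n\<close>.\<close>
  define n where "n = r (nat (Max (range g) - h0))"
  have mono: "f s (r 0) \<le> f s n" for s using r(2) by (auto simp: mono_def n_def)
  have g1: "g j \<le> C n j" for j using mono[of "Inl j"] by (simp add: f_def g_def)
  have g2: "min (C n j) h0 \<le> min (g j) h0" for j
    using mono[of "Inr (Inl j)"] by (simp add: f_def g_def)
  have g3: "dim (V g) \<le> dim (V (C n))"
    using mono[of "Inr (Inr ())"] by (simp add: f_def g_def)
  have "g j \<le> Max (range g)" for j by simp
  moreover have "Max (range g) \<le> h0 + int n"
    using strict_mono_imp_increasing[OF r(1), of "nat (Max (range g) - h0)"]
    unfolding n_def by linarith
  ultimately have g4: "g j \<le> h0 + int n" for j using order_trans by blast
  have gA: "g j \<le> A n j" for j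
    using g1[of j] g4[of j] A_le[of n j] A_high[of n j] by linarith
  have "stable_le h0 g (A n)"
    unfolding stable_le_def le_fun_def
  proof (intro conjI allI impI)
    fix j
    show "g j \<le> A n j" by (rule gA)
    show "h0 \<le> g j" if "g j < A n j"
      using that g2[of j] A_le[of n j] by (auto simp: min_def split: if_splits)
  qed
  then have "dim (V (A n)) \<le> dim (V g)" by (intro dim_le_of_surj surj)
  moreover have "stable_le h0 (A n) (C n)" using A(1)[of n] by (auto simp: stable_le_def)
  then have "dim (V (C n)) < dim (V (A n))" using A by (intro dim_le_of_surj(2) surj) auto
  ultimately show False using g3 by simp
qed

text \<open>The degree \<open>c\<close> part of the submodule N_J. Here \<open>l\<close> is the
  coordinate reached, so the power of x_j that kills \<open>v\<close> has exponent
  \<open>l - c j\<close>.\<close>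

definition torsion :: "'n set \<Rightarrow> ('n \<Rightarrow> int) \<Rightarrow> 'm set" where
  "torsion J c = {v \<in> V c. \<forall>j\<in>J. \<exists>l\<ge>c j. T c (c(j := l)) v = 0}"

lemma torsion_empty [simp]: "torsion {} c = V c"
  by (simp add: torsion_def)

lemma torsion_subset: "torsion J c \<subseteq> V c"
  by (auto simp: torsion_def)

lemma torsion_antimono: "J \<subseteq> J' \<Longrightarrow> torsion J' c \<subseteq> torsion J c"
  by (auto simp: torsion_def)

lemma T_zero_upward: "T a b x = 0 \<Longrightarrow> a \<le> b \<Longrightarrow> b \<le> c \<Longrightarrow> T a c x = 0"
  using T_trans[of a b c x] by simp

lemma subspace_torsion: "subspace (torsion J c)"
proof (rule subspaceI)
  show "0 \<in> torsion J c" using subspace_0[OF subspace_V] by (auto simp: torsion_def)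
  show "scale k x \<in> torsion J c" if "x \<in> torsion J c" for k x
    using that subspace_scale[OF subspace_V] by (fastforce simp: torsion_def T_scale)
  show "x + y \<in> torsion J c" if x: "x \<in> torsion J c" and y: "y \<in> torsion J c" for x y
  proof -
    have "\<exists>l\<ge>c j. T c (c(j := l)) (x + y) = 0" if "j \<in> J" for j
    proof -
      obtain l l' where l: "l \<ge> c j" "T c (c(j := l)) x = 0" "l' \<ge> c j" "T c (c(j := l')) y = 0"
        using x y \<open>j \<in> J\<close> by (force simp: torsion_def)
      then have "T c (c(j := max l l')) x = 0" "T c (c(j := max l l')) y = 0"
        by (auto simp: le_fun_def intro: T_zero_upward[of c "c(j := l)"] T_zero_upward[of c "c(j := l')"])
      then show ?thesis using l by (intro exI[of _ "max l l'"]) (auto simp: T_add)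
    qed
    then show ?thesis using x y subspace_add[OF subspace_V] by (auto simp: torsion_def)
  qed
qed

lemma T_torsion:
  assumes "c \<le> b" "v \<in> torsion J c"
  shows "T c b v \<in> torsion J b"
proof -
  have "\<exists>l\<ge>b j. T b (b(j := l)) (T c b v) = 0" if j: "j \<in> J" for j
  proof -
    obtain l where l: "l \<ge> c j" "T c (c(j := l)) v = 0" using assms j by (auto simp: torsion_def)
    have le: "c j \<le> b j" using assms(1) by (simp add: le_fun_def)
    \<comment> \<open>The same exponent \<open>l - c j\<close>, now counted from
      \<open>b j\<close>.\<close>
    let ?l = "b j + l - c j"
    have "c(j := l) \<le> b(j := ?l)" "c \<le> c(j := l)" "b \<le> b(j := ?l)"
      using assms(1) l le by (auto simp: le_fun_def)
    then have "T b (b(j := ?l)) (T c b v) = 0"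
      using T_trans[OF assms(1), of "b(j := ?l)" v] T_zero_upward[OF l(2)] by simp
    then show ?thesis using l by (intro exI[of _ ?l]) auto
  qed
  then show ?thesis using assms T_in by (auto simp: torsion_def)
qed

text \<open>Powers of x_i are regular on N_J modulo its x_i-torsion: if one of them moves
  \<open>v\<close> into the torsion, a higher one kills \<open>v\<close>.\<close>

lemma torsion_regular:
  assumes v: "v \<in> torsion J c" and l: "c i \<le> l" and T: "T c (c(i := l)) v \<in> torsion (insert i J) (c(i := l))"
  shows "v \<in> torsion (insert i J) c"
proof -
  obtain l' where l': "l' \<ge> l" "T (c(i := l)) (c(i := l')) (T c (c(i := l)) v) = 0"
    using T by (auto simp: torsion_def)
  then have "T c (c(i := l')) v = 0"
    using l T_trans[of c "c(i := l)" "c(i := l')" v] by (simp add: le_fun_def)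
  then show ?thesis using v l l' by (auto simp: torsion_def intro!: exI[of _ l'])
qed

text \<open>Among the nonzero monomial multiples of \<open>v\<close>, one of largest total degree is
  killed by every variable. The maximum exists because the killing powers bound each
  coordinate.\<close>

lemma torsion_UNIV_socle:
  assumes v: "v \<in> torsion UNIV c" "v \<noteq> 0"
  shows "\<exists>b z. z \<in> V b \<and> z \<noteq> 0 \<and> (\<forall>j. T b (b(j := b j + 1)) z = 0)"
proof -
  have "\<forall>j. \<exists>l. l \<ge> c j \<and> T c (c(j := l)) v = 0" using v by (auto simp: torsion_def)
  then obtain l where l: "\<And>j. l j \<ge> c j" "\<And>j. T c (c(j := l j)) v = 0" by metis
  let ?P = "\<lambda>b. c \<le> b \<and> T c b v \<noteq> 0"
  have bound: "b j < l j" if "?P b" for b j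
  proof (rule ccontr)
    assume "\<not> b j < l j"
    then have "c(j := l j) \<le> b" "c \<le> c(j := l j)" using that l(1)[of j] by (auto simp: le_fun_def)
    then have "T c b v = 0" using T_zero_upward[OF l(2)[of j]] by blast
    then show False using that by simp
  qed
  have "?P c" using v by (simp add: T_refl)
  moreover have "nat (\<Sum>j\<in>UNIV. b j - c j) < nat (\<Sum>j\<in>UNIV. l j - c j) + 1" if "?P b" for b
    using bound[OF that] by (intro le_imp_less_Suc[unfolded Suc_eq_plus1] nat_mono sum_mono) (simp add: less_imp_le)
  ultimately obtain b where b: "?P b" and
      max: "\<And>b'. ?P b' \<Longrightarrow> nat (\<Sum>j\<in>UNIV. b' j - c j) \<le> nat (\<Sum>j\<in>UNIV. b j - c j)"
    using ex_has_greatest_nat[of ?P c "\<lambda>b. nat (\<Sum>j\<in>UNIV. b j - c j)"] by blast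
  have "T b (b(j := b j + 1)) (T c b v) = 0" for j
  proof (rule ccontr)
    let ?b = "b(j := b j + 1)"
    assume "\<not> ?thesis"
    moreover have le: "b \<le> ?b" by (auto simp: le_fun_def)
    ultimately have "?P ?b" using T_trans[of c b ?b v] b by auto
    then have "nat (\<Sum>j\<in>UNIV. ?b j - c j) \<le> nat (\<Sum>j\<in>UNIV. b j - c j)" by (rule max)
    moreover have "(\<Sum>j\<in>UNIV. b j - c j) < (\<Sum>j\<in>UNIV. ?b j - c j)"
      by (intro sum_strict_mono_ex1) auto
    moreover have "0 \<le> (\<Sum>j\<in>UNIV. b j - c j)" using b by (intro sum_nonneg) (simp add: le_fun_def)
    ultimately show False by linarith
  qed
  then show ?thesis using b T_in v torsion_subset by blast
qed

end

section \<open>Stanley bases, one degree at a time\<close>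

definition reaches :: "('n \<Rightarrow> int) \<times> 'm \<times> 'n set \<Rightarrow> ('n \<Rightarrow> int) \<Rightarrow> bool" where
  "reaches = (\<lambda>(a, m, Z) c. a \<le> c \<and> (\<forall>j. a j < c j \<longrightarrow> j \<in> Z))"

context persistence_module
begin

definition transport :: "('n \<Rightarrow> int) \<Rightarrow> ('n \<Rightarrow> int) \<times> 'm \<times> 'n set \<Rightarrow> 'm" where
  "transport c = (\<lambda>(a, m, Z). T a c m)"

text \<open>A triple \<^term>\<open>(a, m, Z)\<close> encodes the Stanley space \<open>m K[Z]\<close> with \<open>m\<close> in degree \<open>a\<close>;
  its part of degree \<open>c\<close> is spanned by the single element \<^term>\<open>transport c (a, m, Z)\<close>, or
  is zero if \<^term>\<open>\<not> reaches (a, m, Z) c\<close>.\<close>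

definition stanley_basis ::
    "(('n \<Rightarrow> int) \<Rightarrow> 'm set) \<Rightarrow> (('n \<Rightarrow> int) \<Rightarrow> 'm set) \<Rightarrow> (('n \<Rightarrow> int) \<times> 'm \<times> 'n set) set \<Rightarrow> bool" where
  "stanley_basis A B D \<longleftrightarrow> finite D \<and>
     (\<forall>c. relative_basis {d \<in> D. reaches d c} (transport c) (A c) (B c))"

text \<open>Glues consecutive layers of a filtration; in each degree it is
  \<open>relative_basis_Un\<close>.\<close>

lemma stanley_basis_Un:
  assumes D: "stanley_basis A B D" and E: "stanley_basis B C E"
    and "\<And>c. subspace (B c)" "\<And>c. A c \<subseteq> B c" "\<And>c. B c \<subseteq> C c"
  shows "stanley_basis A C (D \<union> E)"
proof -
  have "{d \<in> D \<union> E. reaches d c} = {d \<in> D. reaches d c} \<union> {d \<in> E. reaches d c}" for c by blast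
  moreover have "relative_basis ({d \<in> D. reaches d c} \<union> {d \<in> E. reaches d c}) (transport c) (A c) (C c)" for c
    using D E assms(3-5) by (intro relative_basis_Un[of _ _ _ "B c"]) (simp_all add: stanley_basis_def)
  ultimately show ?thesis using D E by (simp add: stanley_basis_def)
qed

end

text \<open>The module vanishes below \<open>lo\<close>, and maps that increase only coordinates
  already at least \<open>h\<close> are isomorphisms. So the finitely many degrees of
  \<open>box\<close> determine everything.\<close>

locale stable_persistence_module = persistence_module scale V T
  for scale :: "'k::field \<Rightarrow> 'm::ab_group_add \<Rightarrow> 'm"
    and V :: "('n::finite \<Rightarrow> int) \<Rightarrow> 'm set"
    and T :: "('n \<Rightarrow> int) \<Rightarrow> ('n \<Rightarrow> int) \<Rightarrow> 'm \<Rightarrow> 'm" +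
  fixes lo h :: int
  assumes lo_le_h: "lo \<le> h"
    and V_below: "a j < lo \<Longrightarrow> V a = {0}"
    and T_surj: "stable_le h a c \<Longrightarrow> V c \<subseteq> T a c ` V a"
    and T_inj: "stable_le h a c \<Longrightarrow> x \<in> V a \<Longrightarrow> T a c x = 0 \<Longrightarrow> x = 0"
begin

definition box :: "('n \<Rightarrow> int) set" where
  "box = {a. \<forall>j. lo \<le> a j \<and> a j \<le> h}"

lemma finite_box: "finite box"
proof -
  have "box = (\<Pi>\<^sub>E j\<in>UNIV. {lo..h})" by (auto simp: box_def PiE_def)
  then show ?thesis by (simp add: finite_PiE)
qed

lemma torsion_below: "c j < lo \<Longrightarrow> torsion J c = {0}"
  using torsion_subset[of J c] V_below[of c j] subspace_0[OF subspace_torsion[of J c]] by auto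

text \<open>Setting coordinate \<open>j\<close> to \<open>l\<close> in both \<open>c\<close> and
  \<open>b\<close> leaves the step between them stable, hence injective. So a power of x_j that
  kills the image of \<open>v\<close> kills \<open>v\<close> as well.\<close>

lemma torsion_reflect:
  assumes s: "stable_le h c b" and v: "v \<in> V c" and T: "T c b v \<in> torsion J b"
  shows "v \<in> torsion J c"
proof -
  have "\<exists>l\<ge>c j. T c (c(j := l)) v = 0" if j: "j \<in> J" for j
  proof -
    obtain l where l: "l \<ge> b j" "T b (b(j := l)) (T c b v) = 0" using T j by (auto simp: torsion_def)
    have cb: "c \<le> b" using s by (simp add: stable_le_def)
    then have le: "b \<le> b(j := l)" "c(j := l) \<le> b(j := l)" "c \<le> c(j := l)" "c j \<le> l"
      using l(1) order_trans[of "c j" "b j" l] by (auto simp: le_fun_def)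
    then have "T (c(j := l)) (b(j := l)) (T c (c(j := l)) v) = 0"
      using T_trans[OF cb, of "b(j := l)" v] T_trans[of c "c(j := l)" "b(j := l)" v] l(2) by simp
    moreover have "stable_le h (c(j := l)) (b(j := l))" using s by (auto simp: stable_le_def le_fun_def)
    ultimately have "T c (c(j := l)) v = 0" using T_inj T_in le v by blast
    then show ?thesis using le by blast
  qed
  then show ?thesis using v by (simp add: torsion_def)
qed

lemma torsion_surj:
  assumes "stable_le h c b" "w \<in> torsion J b"
  obtains v where "v \<in> torsion J c" "w = T c b v"
  using T_surj[OF assms(1)] torsion_reflect[OF assms(1)] assms(2) torsion_subset by blast

text \<open>Powers of x_j are injective from such a degree on. Hence the last layer lives in the box
  and needs only finitely many spaces with \<open>Z\<close> empty.\<close>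

lemma torsion_UNIV_high:
  assumes "h \<le> c j"
  shows "torsion UNIV c = {0}"
proof -
  have "x = 0" if "x \<in> torsion UNIV c" for x
  proof -
    obtain l where "l \<ge> c j" "T c (c(j := l)) x = 0" using \<open>x \<in> torsion UNIV c\<close> by (auto simp: torsion_def)
    moreover from this have "stable_le h c (c(j := l))"
      using assms by (auto simp: stable_le_def le_fun_def)
    ultimately show ?thesis using T_inj that torsion_subset by blast
  qed
  then show ?thesis using subspace_0[OF subspace_torsion] by blast
qed

lemma ex_relative_basis:
  assumes "subspace U" "subspace W" "U \<subseteq> W" "W \<subseteq> V a"
  shows "\<exists>C. relative_basis C id U W"
proof -
  obtain B where "finite B" "V a \<subseteq> span B" using finite_dim by blast
  then show ?thesis using relative_basis_exists[of U W B] assms by blast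
qed

text \<open>The variable \<open>x\<^sub>i\<close> is regular on \<^term>\<open>torsion J\<close> modulo \<^term>\<open>torsion (insert i J)\<close>. So a
  relative Stanley basis, with \<open>i\<close> in all \<open>Z\<close>, is obtained from vector space bases modulo \<open>x\<^sub>i\<close>,
  chosen in the finitely many degrees of the box and transported in the directions in which the
  boundary of the box has been reached.\<close>

lemma ex_stanley_basis_torsion_step:
  "\<exists>E. stanley_basis (torsion (insert i J)) (torsion J) E \<and> (\<forall>(a, m, Z)\<in>E. i \<in> Z)"
proof -
  let ?N = "torsion J" and ?N' = "torsion (insert i J)"
  have N'N: "?N' c \<subseteq> ?N c" for c by (rule torsion_antimono) auto
  define pred where "pred c = c(i := c i - 1)" for c :: "'n \<Rightarrow> int"
  have pred_le: "pred c \<le> c" for c by (auto simp: pred_def le_fun_def)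
  \<comment> \<open>\<open>U\<close> is N' + x_i N, so \<open>C a\<close> below is a basis, in
    degree \<open>a\<close>, of N/N' modulo its multiples of x_i.\<close>
  define U where "U c = {x + T (pred c) c y | x y. x \<in> ?N' c \<and> y \<in> ?N (pred c)}" for c
  have subspace_U: "subspace (U c)" for c
  proof -
    have "subspace {T (pred c) c y | y. y \<in> ?N (pred c)}"
      using subspace_torsion[of J "pred c"]
      unfolding subspace_def by (auto simp flip: T_add T_scale) (metis T_zero)
    then have "subspace {x + y | x y. x \<in> ?N' c \<and> y \<in> {T (pred c) c y | y. y \<in> ?N (pred c)}}"
      by (intro subspace_sums subspace_torsion)
    moreover have "{x + y | x y. x \<in> ?N' c \<and> y \<in> {T (pred c) c y | y. y \<in> ?N (pred c)}} = U c"
      unfolding U_def by blast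
    ultimately show ?thesis by simp
  qed
  have UN: "U c \<subseteq> ?N c" for c
    unfolding U_def using N'N T_torsion[OF pred_le] by (blast intro: subspace_add[OF subspace_torsion])
  have N'U: "?N' c \<subseteq> U c" for c
    using subspace_0[OF subspace_torsion[of J "pred c"]] by (force simp: U_def)
  have TU: "T (pred c) c y \<in> U c" if "y \<in> ?N (pred c)" for c y
    using subspace_0[OF subspace_torsion[of "insert i J" c]] that by (force simp: U_def)
  have "\<exists>C. \<forall>a. relative_basis (C a) id (U a) (?N a)"
    using ex_relative_basis[OF subspace_U subspace_torsion UN torsion_subset] by metis
  then obtain C where C: "\<And>a. relative_basis (C a) id (U a) (?N a)" by blast
  define Z where "Z a = insert i {j. a j = h}" for a :: "'n \<Rightarrow> int"
  define E where "E = {(a, m, Z a) | a m. a \<in> box \<and> m \<in> C a}"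
  have "E = (\<Union>a\<in>box. (\<lambda>m. (a, m, Z a)) ` C a)" by (auto simp: E_def)
  then have finE: "finite E" using finite_box relative_basis_finite[OF C] by auto
  define R where "R c = {d \<in> E. reaches d c}" for c
  \<comment> \<open>Two layers in degree \<open>c\<close>: the multiples of x_i, whose basis comes
    from degree \<open>pred c\<close>, and the quotient by them, whose basis consists of the triples
    that reach \<open>c\<close> but not \<open>pred c\<close>.\<close>
  have step: "relative_basis (R c) (transport c) (?N' c) (?N c)"
    if IH: "relative_basis (R (pred c)) (transport (pred c)) (?N' (pred c)) (?N (pred c))" for c
  proof -
    have R_pred: "R (pred c) \<subseteq> R c"
      by (auto simp: R_def E_def reaches_def pred_def le_fun_def Z_def split: if_splits)
    \<comment> \<open>By \<open>torsion_regular\<close>, x_i is injective modulo N', and its image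
      there is \<open>U c\<close>.\<close>
    have "relative_basis (R (pred c)) (\<lambda>d. T (pred c) c (transport (pred c) d)) (?N' c) (U c)"
    proof (rule relative_basis_image[OF IH])
      show "T (pred c) c w \<in> ?N' c \<longleftrightarrow> w \<in> ?N' (pred c)" if "w \<in> ?N (pred c)" for w
        using torsion_regular[of w J "pred c" i "c i"] that T_torsion[OF pred_le]
        by (auto simp: pred_def)
      show "\<exists>w\<in>?N (pred c). w' - T (pred c) c w \<in> ?N' c" if "w' \<in> U c" for w'
        using that by (force simp: U_def)
    qed (use subspace_torsion T_add T_scale TU N'N in auto)
    then have "relative_basis (id ` R (pred c)) (transport c) (?N' c) (U c)"
      by (rule relative_basis_reindex)
        (auto simp: transport_def R_def reaches_def T_trans pred_le)
    then have 1: "relative_basis (R (pred c)) (transport c) (?N' c) (U c)" by simp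
    \<comment> \<open>The only degree in which a new triple can start: its \<open>i\<close>-th
      coordinate must be that of \<open>c\<close>, and any other coordinate may fall short of
      \<open>c\<close> only by being stopped at \<open>h\<close>.\<close>
    define b where "b = (\<lambda>j. if j = i then c j else min (c j) h)"
    have new: "R c - R (pred c) = {(a, m, Z a) | a m. a = b \<and> b \<in> box \<and> m \<in> C b}"
      (is "_ = ?new")
    proof
      show "R c - R (pred c) \<subseteq> ?new"
      proof
        fix d assume d: "d \<in> R c - R (pred c)"
        then obtain a m where a: "d = (a, m, Z a)" "a \<in> box" "m \<in> C a" by (auto simp: R_def E_def)
        have ac: "a j \<le> c j" "a j < c j \<Longrightarrow> j = i \<or> a j = h" for j
          using d a by (auto simp: R_def reaches_def le_fun_def Z_def)
        have "a i = c i"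
        proof (rule ccontr)
          assume "a i \<noteq> c i"
          then have "a i \<le> c i - 1" using ac(1)[of i] by simp
          then have "reaches d (pred c)"
            using ac unfolding a(1) by (auto simp: reaches_def le_fun_def pred_def Z_def)
          then show False using d by (auto simp: R_def)
        qed
        then have "a j = b j" for j 
          using ac[of j] a(2) by (cases "a j < c j") (auto simp: b_def box_def min_def dest: spec[of _ j])
        then have "a = b" by (rule ext)
        then show "d \<in> ?new" using a by blast
      qed
      show "?new \<subseteq> R c - R (pred c)"
        by (auto simp: R_def E_def reaches_def b_def Z_def pred_def le_fun_def split: if_splits)
    qed
    have 2: "relative_basis (R c - R (pred c)) (transport c) (U c) (?N c)"
    proof (cases "b \<in> box")
      case True
      \<comment> \<open>From \<open>b\<close> to \<open>c\<close>, and from \<open>pred b\<close> to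
        \<open>pred c\<close>, only coordinates already at \<open>h\<close> increase. Both maps are
        bijective on torsion, so N/U is the same in degrees \<open>b\<close> and
        \<open>c\<close>.\<close>
      have sb: "stable_le h b c"
        by (auto simp: stable_le_def b_def le_fun_def)
      then have bc: "b \<le> c" by (simp add: stable_le_def)
      have sp: "stable_le h (pred b) (pred c)"
        by (auto simp: stable_le_def b_def le_fun_def pred_def)
      then have pbc: "pred b \<le> pred c" by (simp add: stable_le_def)
      have TT: "T b c (T (pred b) b y) = T (pred c) c (T (pred b) (pred c) y)" for y
        using T_trans[OF pred_le bc] T_trans[OF pbc pred_le] by simp
      have "relative_basis (C b) (\<lambda>m. T b c (id m)) (U c) (?N c)"
      proof (rule relative_basis_image[OF C])
        show "T b c w \<in> ?N c" if "w \<in> ?N b" for w using that T_torsion[OF bc] by blast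
        show "\<exists>w\<in>?N b. w' - T b c w \<in> U c" if w': "w' \<in> ?N c" for w'
        proof -
          obtain w where "w \<in> ?N b" "w' = T b c w" using w' torsion_surj[OF sb] by blast
          then show ?thesis using subspace_0[OF subspace_U] by (intro bexI[of _ w]) auto
        qed
        show "T b c w \<in> U c \<longleftrightarrow> w \<in> U b" if w: "w \<in> ?N b" for w
        proof
          assume "w \<in> U b"
          then obtain x y where x: "w = x + T (pred b) b y" "x \<in> ?N' b" "y \<in> ?N (pred b)"
            by (auto simp: U_def)
          then have "T b c w = T b c x + T (pred c) c (T (pred b) (pred c) y)"
            by (simp add: T_add TT)
          then show "T b c w \<in> U c"
            unfolding U_def using T_torsion[OF bc x(2)] T_torsion[OF pbc x(3)] by blast
        next
          assume "T b c w \<in> U c"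
          then obtain x' y' where w': "T b c w = x' + T (pred c) c y'" "x' \<in> ?N' c" "y' \<in> ?N (pred c)"
            by (auto simp: U_def)
          obtain x where x: "x \<in> ?N' b" "x' = T b c x" using torsion_surj[OF sb w'(2)] by blast
          obtain y where y: "y \<in> ?N (pred b)" "y' = T (pred b) (pred c) y"
            using torsion_surj[OF sp w'(3)] by blast
          let ?z = "x + T (pred b) b y"
          have z: "?z \<in> U b" using x y by (auto simp: U_def)
          have "T b c (w - ?z) = 0" using w' x y by (simp add: T_diff T_add TT)
          moreover have "w - ?z \<in> ?N b" using w z UN by (intro subspace_diff subspace_torsion) auto
          ultimately have "w - ?z = 0" using T_inj[OF sb] torsion_subset by blast
          then show "w \<in> U b" using z by simp
        qed
      qed (use subspace_torsion subspace_U T_add T_scale UN in auto)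
      then have "relative_basis ((\<lambda>m. (b, m, Z b)) ` C b) (transport c) (U c) (?N c)"
        by (rule relative_basis_reindex) (auto simp: transport_def inj_on_def)
      moreover have "(\<lambda>m. (b, m, Z b)) ` C b = R c - R (pred c)" using new True by auto
      ultimately show ?thesis by simp
    next
      case False
      then obtain j where j: "b j < lo \<or> h < b j" by (auto simp: box_def not_le)
      \<comment> \<open>If \<open>b\<close> is below the box, N vanishes in degree \<open>c\<close>.
        If it is above, this happens in coordinate \<open>i\<close>, the others being capped at
        \<open>h\<close>, and then x_i maps onto N in degree \<open>c\<close>.\<close>
      have "?N c \<subseteq> U c"
      proof (cases "b j < lo")
        case True
        then have "c j < lo" using lo_le_h by (auto simp: b_def split: if_splits)
        then show ?thesis using torsion_below subspace_0[OF subspace_U] by auto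
      next
        case False
        then have "h < c i" using j by (auto simp: b_def split: if_splits)
        then have "stable_le h (pred c) c" by (auto simp: stable_le_def pred_def le_fun_def)
        then show ?thesis using torsion_surj[of "pred c" c] TU by blast
      qed
      then have "?N c = U c" using UN by blast
      moreover have "R c - R (pred c) = {}" using new False by auto
      ultimately show ?thesis by (simp only: relative_basis_empty[OF subspace_U])
    qed
    have "relative_basis (R (pred c) \<union> (R c - R (pred c))) (transport c) (?N' c) (?N c)"
      using 1 2 subspace_U N'U UN by (rule relative_basis_Un)
    then show ?thesis using R_pred by (simp add: Un_absorb1)
  qed
  \<comment> \<open>Induction along x_i, starting below \<open>lo\<close>, where N is zero and no
    triple arrives.\<close>
  have "relative_basis (R c) (transport c) (?N' c) (?N c)" if "c i < lo + int n" for n c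
    using that
  proof (induction n arbitrary: c)
    case 0
    have "lo \<le> c i" if "d \<in> R c" for d
    proof -
      obtain a where "a \<in> box" "a \<le> c" using \<open>d \<in> R c\<close> by (auto simp: R_def E_def reaches_def)
      then show ?thesis using order_trans[of lo "a i" "c i"] by (auto simp: box_def le_fun_def)
    qed
    then have "R c = {}" using 0 by force
    then show ?case
      using 0 torsion_below[of c i] relative_basis_empty[of "{0}"] by (simp add: subspace_single_0)
  next
    case (Suc n)
    have "pred c i < lo + int n" using Suc.prems by (simp add: pred_def)
    then show ?case using Suc.IH step by blast
  qed
  moreover have "c i < lo + int (nat (c i - lo + 1))" for c :: "'n \<Rightarrow> int" by linarith
  ultimately have "relative_basis (R c) (transport c) (?N' c) (?N c)" for c by blast
  then have "stanley_basis ?N' ?N E" using finE by (simp add: stanley_basis_def R_def)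
  then show ?thesis by (intro exI[of _ E]) (auto simp: E_def Z_def)
qed

section \<open>Assembling the layers of the torsion filtration\<close>

lemma ex_stanley_basis_torsion:
  "\<exists>D. stanley_basis (torsion J) V D \<and> (\<forall>(a, m, Z)\<in>D. Z \<noteq> {})"
proof (induction J rule: finite_induct[OF finite])
  case 1
  have "stanley_basis V V {}" by (simp add: stanley_basis_def relative_basis_empty subspace_V)
  then show ?case by (intro exI[of _ "{}"]) (simp add: torsion_empty[abs_def])
next
  case (2 i J)
  then obtain D where D: "stanley_basis (torsion J) V D" "\<forall>(a, m, Z)\<in>D. Z \<noteq> {}" by blast
  obtain E where E: "stanley_basis (torsion (insert i J)) (torsion J) E" "\<forall>(a, m, Z)\<in>E. i \<in> Z"
    using ex_stanley_basis_torsion_step by blast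
  have "stanley_basis (torsion (insert i J)) V (E \<union> D)"
    by (rule stanley_basis_Un[OF E(1) D(1) subspace_torsion torsion_antimono torsion_subset]) auto
  then show ?case using D(2) E(2) by (intro exI[of _ "E \<union> D"]) auto
qed

lemma ex_stanley_basis_torsion_UNIV:
  "\<exists>D. stanley_basis (\<lambda>_. {0}) (torsion UNIV) D \<and> (\<forall>(a, m, Z)\<in>D. m \<in> torsion UNIV a)"
proof -
  have "\<exists>C. \<forall>a. relative_basis (C a) id {0} (torsion UNIV a)"
    using ex_relative_basis[OF subspace_single_0 subspace_torsion _ torsion_subset]
      subspace_0[OF subspace_torsion] by (metis empty_subsetI insert_subset)
  then obtain C where C: "\<And>a. relative_basis (C a) id {0} (torsion UNIV a)" by blast
  define D where "D = (\<Union>a\<in>box. (\<lambda>m. (a, m, {} :: 'n set)) ` C a)"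
  have "relative_basis {d \<in> D. reaches d c} (transport c) {0} (torsion UNIV c)" for c
  proof -
    have "a = c" if "reaches (a, m, {}) c" for a and m :: 'm
      using that by (auto simp: reaches_def le_fun_def fun_eq_iff less_le)
    then have R: "{d \<in> D. reaches d c} = (if c \<in> box then (\<lambda>m. (c, m, {})) ` C c else {})"
      by (auto simp: D_def) (auto simp: reaches_def)
    show ?thesis
    proof (cases "c \<in> box")
      case True
      have "relative_basis ((\<lambda>m. (c, m, {})) ` C c) (transport c) {0} (torsion UNIV c)"
        by (rule relative_basis_reindex[OF C]) (auto simp: transport_def inj_on_def T_refl)
      then show ?thesis using R True by simp
    next
      case False
      then obtain j where "c j < lo \<or> h < c j" by (auto simp: box_def not_le)
      then have "torsion UNIV c = {0}"
        using torsion_below[of c j] torsion_UNIV_high[of c j] by auto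
      moreover have "{d \<in> D. reaches d c} = {}" using False by (subst R) simp
      ultimately show ?thesis by (simp only: relative_basis_empty subspace_single_0)
    qed
  qed
  moreover have "finite D" using finite_box relative_basis_finite[OF C] by (auto simp: D_def)
  moreover have "m \<in> torsion UNIV a" if "(a, m, Z) \<in> D" for a m Z
    using that relative_basis_in[OF C] by (auto simp: D_def)
  ultimately show ?thesis by (intro exI[of _ D]) (auto simp: stanley_basis_def)
qed

text \<open>The disjunction keeps track of the layer: a space with \<open>Z\<close> empty is allowed
  only if its generator is killed by a power of every variable.\<close>

lemma ex_stanley_basis:
  "\<exists>D. stanley_basis (\<lambda>_. {0}) V D \<and> (\<forall>(a, m, Z)\<in>D. Z \<noteq> {} \<or> m \<in> torsion UNIV a)"
proof -
  obtain D where D: "stanley_basis (torsion UNIV) V D" "\<forall>(a, m, Z)\<in>D. Z \<noteq> {}"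
    using ex_stanley_basis_torsion by blast
  obtain E where E: "stanley_basis (\<lambda>_. {0}) (torsion UNIV) E" "\<forall>(a, m, Z)\<in>E. m \<in> torsion UNIV a"
    using ex_stanley_basis_torsion_UNIV by blast
  have "stanley_basis (\<lambda>_. {0}) V (E \<union> D)"
    by (rule stanley_basis_Un[OF E(1) D(1) subspace_torsion _ torsion_subset])
      (simp add: subspace_0[OF subspace_torsion])
  then show ?thesis using D(2) E(2) by (intro exI[of _ "E \<union> D"]) auto
qed

end

section \<open>Homogeneous components\<close>

definition exponent :: "('n::finite \<Rightarrow> nat) \<Rightarrow> 'n \<Rightarrow>\<^sub>0 nat" where
  "exponent f = Abs_poly_mapping f"

lemma lookup_exponent [simp]: "Poly_Mapping.lookup (exponent f) = f"
  by (simp add: exponent_def)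

lemma exponent_lookup [simp]: "exponent (Poly_Mapping.lookup u) = u"
  by (simp add: poly_mapping_eq_iff)

lemma exponent_add: "exponent f + exponent g = exponent (\<lambda>i. f i + g i)"
  by (rule poly_mapping_eqI) (simp add: lookup_add)

lemma sum_single_lookup: "(\<Sum>u\<in>Poly_Mapping.keys p. Poly_Mapping.single u (Poly_Mapping.lookup p u)) = p"
  by (rule poly_mapping_eqI)
    (auto simp: lookup_sum lookup_single when_def in_keys_iff sum.delta)

text \<open>The exponent of the monomial that shifts degree \<open>a\<close> to degree \<open>c\<close>; junk unless \<^term>\<open>a \<le> c\<close>.\<close>

definition expdiff :: "('n::finite \<Rightarrow> int) \<Rightarrow> ('n \<Rightarrow> int) \<Rightarrow> 'n \<Rightarrow>\<^sub>0 nat" where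
  "expdiff a c = exponent (\<lambda>i. nat (c i - a i))"

definition degree_add :: "('n \<Rightarrow> int) \<Rightarrow> ('n \<Rightarrow>\<^sub>0 nat) \<Rightarrow> 'n \<Rightarrow> int" where
  "degree_add a u = (\<lambda>i. a i + int (Poly_Mapping.lookup u i))"

definition degree_sub :: "('n \<Rightarrow> int) \<Rightarrow> ('n \<Rightarrow>\<^sub>0 nat) \<Rightarrow> 'n \<Rightarrow> int" where
  "degree_sub c u = (\<lambda>i. c i - int (Poly_Mapping.lookup u i))"

lemma degree_add_sub [simp]: "degree_add (degree_sub c u) u = c" "degree_sub (degree_add c u) u = c"
  by (simp_all add: degree_add_def degree_sub_def)

lemma degree_add_expdiff: "a \<le> c \<Longrightarrow> degree_add a (expdiff a c) = c"
  by (auto simp: degree_add_def expdiff_def le_fun_def)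

lemma expdiff_degree_add [simp]: "expdiff a (degree_add a u) = u"
  by (simp add: degree_add_def expdiff_def)

lemma expdiff_degree_sub [simp]: "expdiff (degree_sub c u) c = u"
  by (simp add: degree_sub_def expdiff_def)

lemma degree_sub_le: "degree_sub c u \<le> c" "c \<le> degree_add c u"
  by (simp_all add: degree_add_def degree_sub_def le_fun_def)

lemma degree_sub_eq_iff: "degree_sub c u = a \<longleftrightarrow> a \<le> c \<and> u = expdiff a c"
  using degree_add_expdiff[of a c] degree_sub_le(1)[of c u] by (metis degree_add_sub(2) expdiff_degree_sub)

lemma expdiff_trans: "a \<le> b \<Longrightarrow> b \<le> c \<Longrightarrow> expdiff b c + expdiff a b = expdiff a c"
  unfolding expdiff_def exponent_add
  by (rule arg_cong[of _ _ exponent]) (auto simp: le_fun_def fun_eq_iff nat_add_distrib[symmetric])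

lemma expdiff_refl [simp]: "expdiff a a = 0"
  by (rule poly_mapping_eqI) (simp add: expdiff_def)

lemma expdiff_succ: "expdiff b (b(j := b j + 1)) = Poly_Mapping.single j 1"
  by (rule poly_mapping_eqI) (simp add: expdiff_def lookup_single when_def)

lemma degree_sub_single: "degree_sub c (Poly_Mapping.single j 1) = c(j := c j - 1)"
  by (auto simp: degree_sub_def lookup_single when_def fun_eq_iff)

lemma keys_expdiff: "Poly_Mapping.keys (expdiff a c) = {j. a j < c j}"
  by (auto simp: in_keys_iff expdiff_def)

sublocale multigraded_module \<subseteq> K: linear_space scaleK
  by (rule linear_space.intro) (rule vector_space_scaleK)

context multigraded_module
begin

definition component :: "('n \<Rightarrow> int) \<Rightarrow> 'm \<Rightarrow> 'm" where
  "component a x = Poly_Mapping.lookup (THE f. (\<forall>i. Poly_Mapping.lookup f i \<in> comp i) \<and>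
     x = (\<Sum>i\<in>Poly_Mapping.keys f. Poly_Mapping.lookup f i)) a"

definition support :: "'m \<Rightarrow> ('n \<Rightarrow> int) set" where
  "support x = {a. component a x \<noteq> 0}"

lemma component_poly_mapping:
  "\<exists>!f. (\<forall>i. Poly_Mapping.lookup f i \<in> comp i) \<and> x = (\<Sum>i\<in>Poly_Mapping.keys f. Poly_Mapping.lookup f i)"
  using direct_sum_comp unfolding direct_sum_def by simp

lemma
  shows component_in: "component a x \<in> comp a"
    and finite_support: "finite (support x)"
    and sum_component: "(\<Sum>a\<in>support x. component a x) = x"
proof -
  define f where "f = (THE f. (\<forall>i. Poly_Mapping.lookup f i \<in> comp i) \<and>
     x = (\<Sum>i\<in>Poly_Mapping.keys f. Poly_Mapping.lookup f i))"
  have "(\<forall>i. Poly_Mapping.lookup f i \<in> comp i) \<and>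
     x = (\<Sum>i\<in>Poly_Mapping.keys f. Poly_Mapping.lookup f i)"
    unfolding f_def by (rule theI'[OF component_poly_mapping])
  then have f: "\<forall>i. Poly_Mapping.lookup f i \<in> comp i"
      "(\<Sum>i\<in>Poly_Mapping.keys f. Poly_Mapping.lookup f i) = x"
    by (blast, metis)
  have c: "component b x = Poly_Mapping.lookup f b" for b by (simp add: component_def f_def)
  have s: "support x = Poly_Mapping.keys f" by (auto simp: support_def c in_keys_iff)
  show "component a x \<in> comp a" "finite (support x)" "(\<Sum>a\<in>support x. component a x) = x"
    using f by (simp_all add: c s)
qed

lemma component_eqI:
  assumes A: "finite A" "x = (\<Sum>a\<in>A. g a)" "\<And>a. a \<in> A \<Longrightarrow> g a \<in> comp a"
  shows "component a x = (if a \<in> A then g a else 0)"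
proof -
  define f where "f = Abs_poly_mapping (\<lambda>a. if a \<in> A then g a else 0)"
  have "finite {a. (if a \<in> A then g a else 0) \<noteq> 0}"
    by (rule finite_subset[OF _ A(1)]) auto
  then have f: "Poly_Mapping.lookup f = (\<lambda>a. if a \<in> A then g a else 0)"
    by (simp add: f_def)
  then have "Poly_Mapping.keys f = {a \<in> A. g a \<noteq> 0}"
    by (auto simp: in_keys_iff f split: if_splits)
  then have "(\<Sum>i\<in>Poly_Mapping.keys f. Poly_Mapping.lookup f i) = (\<Sum>a\<in>A. g a)"
    using A(1) by (auto simp: f intro!: sum.mono_neutral_cong_left)
  moreover have "\<forall>i. Poly_Mapping.lookup f i \<in> comp i" using A(3) zero_closed by (simp add: f)
  ultimately have "(THE f. (\<forall>i. Poly_Mapping.lookup f i \<in> comp i) \<and>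
     x = (\<Sum>i\<in>Poly_Mapping.keys f. Poly_Mapping.lookup f i)) = f"
    using A(2) by (intro the1_equality[OF component_poly_mapping]) simp
  then show ?thesis by (simp add: component_def f)
qed

lemma component_homogeneous: "x \<in> comp b \<Longrightarrow> component a x = (if a = b then x else 0)"
  using component_eqI[of "{b}" x "\<lambda>_. x" a] by simp

lemma sum_component_superset:
  assumes "finite A" "support x \<subseteq> A"
  shows "(\<Sum>a\<in>A. component a x) = x"
proof -
  have "(\<Sum>a\<in>A. component a x) = (\<Sum>a\<in>support x. component a x)"
    using assms by (intro sum.mono_neutral_right) (auto simp: support_def)
  then show ?thesis by (simp add: sum_component)
qed

lemma component_add: "component a (x + y) = component a x + component a y"
proof -
  let ?A = "support x \<union> support y"
  have "x + y = (\<Sum>a\<in>?A. component a x + component a y)"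
    using finite_support by (simp add: sum.distrib sum_component_superset)
  from component_eqI[OF _ this, of a] show ?thesis
    using finite_support component_in add_closed by (auto simp: support_def split: if_splits)
qed

lemma component_zero [simp]: "component a 0 = 0"
  using component_add[of a 0 0] by simp

lemma component_sum: "component a (\<Sum>i\<in>I. f i) = (\<Sum>i\<in>I. component a (f i))"
  by (induction I rule: infinite_finite_induct) (auto simp: component_add)

text \<open>Multiplication by a monomial translates degrees injectively, so it turns the homogeneous
  decomposition of \<open>x\<close> into that of the product.\<close>

lemma component_scale_single:
  "component c (scale (Poly_Mapping.single u k) x) =
    scale (Poly_Mapping.single u k) (component (degree_sub c u) x)"
proof -
  let ?s = "scale (Poly_Mapping.single u k)"
  let ?A = "(\<lambda>a. degree_add a u) ` support x"
  have inj: "inj (\<lambda>a. degree_add a u)" by (metis injI degree_add_sub(2))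
  have "?s x = (\<Sum>a\<in>support x. ?s (component a x))"
    by (simp add: sum_component flip: scale_sum_right)
  also have "\<dots> = (\<Sum>c\<in>?A. ?s (component (degree_sub c u) x))"
    by (subst sum.reindex) (use inj in \<open>auto intro: inj_on_subset\<close>)
  finally have *: "?s x = (\<Sum>c\<in>?A. ?s (component (degree_sub c u) x))" .
  have "?s (component (degree_sub c u) x) \<in> comp c" for c
    using monomial_scale_closed[OF component_in[of "degree_sub c u" x], of u k]
    by (simp flip: degree_add_def)
  then have "component c (?s x) = (if c \<in> ?A then ?s (component (degree_sub c u) x) else 0)"
    using finite_support by (intro component_eqI[OF _ *]) auto
  moreover have "component (degree_sub c u) x = 0" if "c \<notin> ?A"
    using that by (metis (mono_tags, lifting) degree_add_sub(1) image_eqI mem_Collect_eq support_def)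
  ultimately show ?thesis by auto
qed

lemma scale_eq_sum_single:
  "scale p x = (\<Sum>u\<in>Poly_Mapping.keys p. scale (Poly_Mapping.single u (Poly_Mapping.lookup p u)) x)"
  by (simp add: sum_single_lookup flip: scale_sum_left)

section \<open>Multiplication by monomials as maps between components\<close>

definition shift :: "('n \<Rightarrow> int) \<Rightarrow> ('n \<Rightarrow> int) \<Rightarrow> 'm \<Rightarrow> 'm" where
  "shift a c x = scale (Poly_Mapping.single (expdiff a c) 1) x"

lemma scale_single_eq: "scale (Poly_Mapping.single u k) x = scaleK k (scale (Poly_Mapping.single u 1) x)"
  by (simp add: scaleK_def Const_def mult_single)

text \<open>Only the monomial x^(c - a) leads from degree \<open>a\<close> to degree
  \<open>c\<close>, so each component of the product shows a single coefficient of
  \<open>p\<close>.\<close>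

lemma component_scale_homogeneous:
  assumes "m \<in> comp a"
  shows "component c (scale p m) =
    (if a \<le> c then scaleK (Poly_Mapping.lookup p (expdiff a c)) (shift a c m) else 0)"
proof -
  have "component c (scale p m) = (\<Sum>u\<in>Poly_Mapping.keys p.
      if u = expdiff a c then if a \<le> c then scaleK (Poly_Mapping.lookup p u) (shift a c m) else 0 else 0)"
    unfolding scale_eq_sum_single[of p m] component_sum component_scale_single
    by (intro sum.cong refl)
      (auto simp: component_homogeneous[OF assms] degree_sub_eq_iff shift_def
        simp flip: scale_single_eq)
  then show ?thesis by (simp add: sum.delta in_keys_iff)
qed

lemma shift_succ: "shift b (b(j := b j + 1)) x = scale (Var j) x"
  by (simp add: shift_def expdiff_succ Var_def)

lemma component_scale_Var: "component c (scale (Var j) x) = scale (Var j) (component (c(j := c j - 1)) x)"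
  by (simp add: Var_def component_scale_single degree_sub_single[unfolded One_nat_def])

lemma subspace_comp: "K.subspace (comp a)"
  using zero_closed add_closed monomial_scale_closed[of _ a 0]
  by (intro K.subspaceI) (auto simp: scaleK_def Const_def)

lemma shift_in: "a \<le> c \<Longrightarrow> x \<in> comp a \<Longrightarrow> shift a c x \<in> comp c"
  using monomial_scale_closed[of x a "expdiff a c" 1] degree_add_expdiff[of a c]
  by (simp add: shift_def degree_add_def)

lemma shift_add: "shift a c (x + y) = shift a c x + shift a c y"
  by (simp add: shift_def scale_right_distrib)

lemma shift_scaleK: "shift a c (scaleK k x) = scaleK k (shift a c x)"
  by (simp add: shift_def scaleK_def mult.commute)

lemma shift_refl: "shift a a x = x"
  by (simp add: shift_def)

lemma shift_trans: "a \<le> b \<Longrightarrow> b \<le> c \<Longrightarrow> shift b c (shift a b x) = shift a c x"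
  by (simp add: shift_def mult_single expdiff_trans)

end

section \<open>Finitely generated multigraded modules\<close>

locale fg_multigraded_module = multigraded_module scale comp
  for scale :: "('k::field, 'n::finite) polyring \<Rightarrow> 'm::ab_group_add \<Rightarrow> 'm"
    and comp :: "('n \<Rightarrow> int) \<Rightarrow> 'm set" +
  assumes finitely_generated: "finitely_generated scale"
begin

definition gens_at :: "(('n \<Rightarrow> int) \<times> 'm) set \<Rightarrow> ('n \<Rightarrow> int) \<Rightarrow> 'm set" where
  "gens_at G c = {shift b c g | b g. (b, g) \<in> G \<and> b \<le> c}"

text \<open>Take all components of finitely many generators. The elements whose components are
  combinations of monomial multiples of these form a submodule containing the generators.\<close>

lemma homogeneous_generators:
  obtains G where "finite G" "\<And>b g. (b, g) \<in> G \<Longrightarrow> g \<in> comp b" "\<And>c. comp c \<subseteq> K.span (gens_at G c)"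
proof -
  obtain B where B: "finite B" "span B = UNIV"
    using finitely_generated unfolding finitely_generated_def by blast
  define G where "G = (\<Union>y\<in>B. (\<lambda>b. (b, component b y)) ` support y)"
  let ?W = "{x. \<forall>c. component c x \<in> K.span (gens_at G c)}"
  have "subspace ?W"
  proof (rule subspaceI)
    show "0 \<in> ?W" by (simp add: K.span_zero)
    show "x + y \<in> ?W" if "x \<in> ?W" "y \<in> ?W" for x y
      using that by (simp add: component_add K.span_add)
    show "scale p x \<in> ?W" if x: "x \<in> ?W" for p x
    proof -
      have shift: "shift a c y \<in> K.span (gens_at G c)" if "a \<le> c" "y \<in> K.span (gens_at G a)" for a c y
      proof -
        have "gens_at G a \<subseteq> {y. shift a c y \<in> K.span (gens_at G c)}"
        proof
          fix z assume "z \<in> gens_at G a"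
          then obtain b g where "(b, g) \<in> G" "b \<le> a" "z = shift b a g" by (auto simp: gens_at_def)
          then have "shift a c z = shift b c g \<and> (b, g) \<in> G \<and> b \<le> c"
            using that(1) order_trans[of b a c] by (simp add: shift_trans)
          then have "shift a c z \<in> gens_at G c" unfolding gens_at_def by blast
          then show "z \<in> {y. shift a c y \<in> K.span (gens_at G c)}" by (simp add: K.span_base)
        qed
        moreover have "K.subspace {y. shift a c y \<in> K.span (gens_at G c)}"
          using shift_scaleK[of a c 0 0]
          by (intro K.subspaceI) (auto simp: shift_add shift_scaleK K.span_add K.span_scale K.span_zero)
        ultimately show ?thesis using that(2) K.span_minimal by blast
      qed
      have "scale (Poly_Mapping.single u k) y \<in> K.span (gens_at G c)"
        if "y \<in> K.span (gens_at G (degree_sub c u))" for c u k y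
        using shift[OF degree_sub_le(1) that] by (subst scale_single_eq) (simp add: shift_def K.span_scale)
      then show ?thesis using x
        by (subst scale_eq_sum_single) (auto simp: component_sum component_scale_single intro!: K.span_sum)
    qed
  qed
  moreover have "B \<subseteq> ?W"
  proof safe
    fix y c assume y: "y \<in> B"
    show "component c y \<in> K.span (gens_at G c)"
    proof (cases "component c y = 0")
      case False
      then have "(c, component c y) \<in> G" using y by (auto simp: G_def support_def)
      then have "shift c c (component c y) \<in> gens_at G c" unfolding gens_at_def by blast
      then show ?thesis by (simp add: shift_refl K.span_base)
    qed (simp add: K.span_zero)
  qed
  ultimately have W: "component c x \<in> K.span (gens_at G c)" for c x
    using B(2) span_minimal[of B ?W] by blast
  have "comp c \<subseteq> K.span (gens_at G c)" for c
  proof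
    show "x \<in> K.span (gens_at G c)" if "x \<in> comp c" for x
      using W[of c x] component_homogeneous[OF that, of c] by simp
  qed
  moreover have "finite G" using B(1) finite_support by (auto simp: G_def)
  moreover have "g \<in> comp b" if "(b, g) \<in> G" for b g using that component_in by (auto simp: G_def)
  ultimately show ?thesis using that by blast
qed

lemma finite_gens_at: "finite G \<Longrightarrow> finite (gens_at G c)"
  by (rule finite_subset[of _ "(\<lambda>(b, g). shift b c g) ` G"]) (auto simp: gens_at_def)

end

sublocale fg_multigraded_module \<subseteq> P: persistence_module scaleK comp shift
proof
  fix a :: "'n \<Rightarrow> int"
  show "K.subspace (comp a)" by (rule subspace_comp)
  show "\<exists>B. finite B \<and> comp a \<subseteq> K.span B"
    using homogeneous_generators finite_gens_at by metis
qed (simp_all add: shift_in shift_add shift_scaleK shift_refl shift_trans)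

context fg_multigraded_module
begin

text \<open>Above the largest coordinate of a generator the maps are onto: a multiple of a generator
  in degree \<open>c\<close> already factors through degree \<open>a\<close>. Injectivity may
  require a larger bound.\<close>

lemma ex_stable: "\<exists>lo h. stable_persistence_module scaleK comp shift lo h"
proof -
  obtain G where G: "finite G" "\<And>b g. (b, g) \<in> G \<Longrightarrow> g \<in> comp b" "\<And>c. comp c \<subseteq> K.span (gens_at G c)"
    using homogeneous_generators by blast
  \<comment> \<open>The added \<open>0\<close> keeps \<open>Min L\<close> and \<open>Max L\<close>
    meaningful when \<open>G\<close> is empty.\<close>
  define L where "L = insert 0 (\<Union>(b, g)\<in>G. range b)"
  have L: "finite L" using G(1) by (auto simp: L_def)
  have bound: "Min L \<le> b j" "b j \<le> Max L" if "(b, g) \<in> G" for b g j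
    using that L by (force simp: L_def intro: Min_le Max_ge)+
  have below: "\<forall>j. Min L \<le> a j" if "comp a \<noteq> {0}" for a
  proof -
    have "gens_at G a \<noteq> {}"
    proof
      assume "gens_at G a = {}"
      then have "comp a \<subseteq> {0}" using G(3)[of a] by simp
      then show False using that zero_closed by blast
    qed
    then obtain b g where b: "(b, g) \<in> G" "b \<le> a" by (auto simp: gens_at_def)
    then show ?thesis using bound(1) order_trans by (fastforce simp: le_fun_def)
  qed
  have surj: "comp c \<subseteq> shift a c ` comp a" if s: "stable_le (Max L) a c" for a c
  proof -
    have ac: "a \<le> c" using s by (simp add: stable_le_def)
    have "gens_at G c \<subseteq> shift a c ` comp a"
    proof
      fix z assume "z \<in> gens_at G c"
      then obtain b g where b: "(b, g) \<in> G" "b \<le> c" "z = shift b c g" by (auto simp: gens_at_def)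
      have "b j \<le> a j" for j
      proof -
        have "a j < c j \<longrightarrow> Max L \<le> a j" using s by (simp add: stable_le_def)
        then show ?thesis using bound(2)[OF b(1), of j] le_funD[OF b(2), of j] by linarith
      qed
      then have "b \<le> a" by (simp add: le_fun_def)
      then have "z = shift a c (shift b a g)" "shift b a g \<in> comp a"
        using b ac G(2) by (simp_all add: shift_trans shift_in)
      then show "z \<in> shift a c ` comp a" by blast
    qed
    moreover have "K.subspace (shift a c ` comp a)"
    proof (rule K.subspaceI)
      show "0 \<in> shift a c ` comp a"
        by (rule image_eqI[of _ _ 0]) (simp_all add: shift_def zero_closed)
      show "x + y \<in> shift a c ` comp a" if "x \<in> shift a c ` comp a" "y \<in> shift a c ` comp a" for x y
        using that add_closed by (auto simp flip: shift_add)
      show "scaleK k x \<in> shift a c ` comp a" if "x \<in> shift a c ` comp a" for k x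
        using that K.subspace_scale[OF subspace_comp] by (auto simp flip: shift_scaleK)
    qed
    ultimately show ?thesis using G(3)[of c] K.span_minimal by blast
  qed
  obtain h where h: "h \<ge> Max L" "\<And>a c x. stable_le h a c \<Longrightarrow> x \<in> comp a \<Longrightarrow> shift a c x = 0 \<Longrightarrow> x = 0"
    using P.eventually_injective[OF below surj] by blast
  have "stable_persistence_module scaleK comp shift (Min L) h"
  proof
    have "0 \<in> L" by (simp add: L_def)
    then show "Min L \<le> h" using h(1) Min_le[OF L] Max_ge[OF L] by fastforce
    show "comp a = {0}" if "a j < Min L" for a j using below[of a] that leD by blast
    show "comp c \<subseteq> shift a c ` comp a" if "stable_le h a c" for a c
      using that h(1) by (intro surj) (force simp: stable_le_def)
    show "x = 0" if "stable_le h a c" "x \<in> comp a" "shift a c x = 0" for a c x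
      using h(2) that by blast
  qed
  then show ?thesis by blast
qed

end

section \<open>From Stanley bases to Stanley decompositions\<close>

lemma polys_in_iff: "p \<in> polys_in Z \<longleftrightarrow> (\<forall>u. \<not> Poly_Mapping.keys u \<subseteq> Z \<longrightarrow> Poly_Mapping.lookup p u = 0)"
  by (auto simp: polys_in_def in_keys_iff)

lemma polys_in_0: "0 \<in> polys_in Z"
  by (simp add: polys_in_iff)

lemma polys_in_diff: "p \<in> polys_in Z \<Longrightarrow> q \<in> polys_in Z \<Longrightarrow> p - q \<in> polys_in Z"
  by (simp add: polys_in_iff lookup_minus)

lemma polys_in_sum: "(\<And>i. i \<in> I \<Longrightarrow> p i \<in> polys_in Z) \<Longrightarrow> (\<Sum>i\<in>I. p i) \<in> polys_in Z"
  by (simp add: polys_in_iff lookup_sum)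

lemma polys_in_single: "Poly_Mapping.keys u \<subseteq> Z \<Longrightarrow> Poly_Mapping.single u k \<in> polys_in Z"
  by (auto simp: polys_in_def)

context fg_multigraded_module
begin

lemma stanley_basis_comp:
  assumes "P.stanley_basis A comp D" "(a, m, Z) \<in> D"
  shows "m \<in> comp a"
proof -
  have "K.relative_basis {d \<in> D. reaches d a} (P.transport a) (A a) (comp a)"
    using assms(1) by (simp add: P.stanley_basis_def)
  from K.relative_basis_in[OF this, of "(a, m, Z)"] show ?thesis
    using assms(2) by (simp add: reaches_def P.transport_def shift_refl)
qed

text \<open>The coefficient of x^u in \<open>p d\<close> becomes visible in the degree of the
  generator plus \<open>u\<close>; there the relation is one between basis vectors over K.\<close>

lemma stanley_basis_independent:
  assumes SB: "P.stanley_basis (\<lambda>_. {0}) comp D"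
    and p: "\<And>d. d \<in> D \<Longrightarrow> p d \<in> polys_in (snd (snd d))"
    and sum: "(\<Sum>d\<in>D. scale (p d) (fst (snd d))) = 0"
    and d: "d \<in> D"
  shows "p d = 0"
proof (rule poly_mapping_eqI)
  fix u
  have D: "finite D" using SB by (simp add: P.stanley_basis_def)
  show "Poly_Mapping.lookup (p d) u = Poly_Mapping.lookup 0 u"
  proof (cases "Poly_Mapping.keys u \<subseteq> snd (snd d)")
    case False
    then show ?thesis using p[OF d] by (simp add: polys_in_iff)
  next
    case True
    define c where "c = degree_add (fst d) u"
    define r where "r d = Poly_Mapping.lookup (p d) (expdiff (fst d) c)" for d
    have "fst d \<le> c" by (simp add: c_def degree_sub_le)
    moreover have "\<And>j. fst d j < c j \<Longrightarrow> j \<in> Poly_Mapping.keys u"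
      by (auto simp: c_def in_keys_iff degree_add_def)
    ultimately have reach: "reaches d c" using True by (auto simp: reaches_def split_beta)
    have comp: "component c (scale (p d) (fst (snd d))) =
        (if reaches d c then scaleK (r d) (P.transport c d) else 0)" if "d \<in> D" for d
    proof -
      obtain a m Z where amZ: "d = (a, m, Z)" by (cases d)
      have m: "m \<in> comp a" using stanley_basis_comp[OF SB] that amZ by blast
      \<comment> \<open>Here x^(c - a) is not a monomial of K[Z].\<close>
      have "r d = 0" if "a \<le> c" "\<not> reaches d c"
      proof -
        have "\<not> Poly_Mapping.keys (expdiff a c) \<subseteq> Z"
          using that by (auto simp: keys_expdiff reaches_def amZ)
        then show ?thesis using p[OF \<open>d \<in> D\<close>] by (simp add: polys_in_iff r_def amZ)
      qed
      moreover have "a \<le> c" if "reaches d c" using that by (simp add: reaches_def amZ)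
      ultimately show ?thesis
        by (auto simp: component_scale_homogeneous[OF m] amZ P.transport_def r_def)
    qed
    have "0 = (\<Sum>d\<in>D. component c (scale (p d) (fst (snd d))))"
      by (simp add: sum flip: component_sum)
    also have "\<dots> = (\<Sum>d\<in>D. if reaches d c then scaleK (r d) (P.transport c d) else 0)"
      using comp by (intro sum.cong) auto
    also have "\<dots> = (\<Sum>d\<in>{d \<in> D. reaches d c}. scaleK (r d) (P.transport c d))"
      using D by (simp add: sum.inter_filter)
    finally have "r d = 0"
      using SB K.relative_basis_independent[of "{d \<in> D. reaches d c}" "P.transport c" "{0}" "comp c" r d]
        d reach by (simp add: P.stanley_basis_def)
    then show ?thesis by (simp add: r_def c_def)
  qed
qed

lemma stanley_basis_spans:
  assumes SB: "P.stanley_basis (\<lambda>_. {0}) comp D"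
  shows "\<exists>p. (\<forall>d\<in>D. p d \<in> polys_in (snd (snd d))) \<and> (\<Sum>d\<in>D. scale (p d) (fst (snd d))) = x"
proof -
  have D: "finite D" using SB by (simp add: P.stanley_basis_def)
  have "\<forall>c. \<exists>p. (\<forall>d\<in>D. p d \<in> polys_in (snd (snd d))) \<and> (\<Sum>d\<in>D. scale (p d) (fst (snd d))) = component c x"
  proof
    fix c
    have "K.relative_basis {d \<in> D. reaches d c} (P.transport c) {0} (comp c)"
      using SB by (simp add: P.stanley_basis_def)
    from K.relative_basis_spans[OF this component_in[of c x]]
    obtain r where r: "component c x = (\<Sum>d\<in>{d \<in> D. reaches d c}. scaleK (r d) (P.transport c d))"
      by auto
    \<comment> \<open>One monomial for each triple suffices in a single degree; the polynomials for
      \<open>x\<close> are sums of these over its support.\<close>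
    define p where "p d = (if reaches d c then Poly_Mapping.single (expdiff (fst d) c) (r d) else 0)" for d
    have "p d \<in> polys_in (snd (snd d))" for d
      by (auto simp: p_def polys_in_0 reaches_def keys_expdiff split_beta intro!: polys_in_single)
    moreover have "scale (p d) (fst (snd d)) = (if reaches d c then scaleK (r d) (P.transport c d) else 0)" for d
      by (simp add: p_def scale_single_eq[of _ "r d"] P.transport_def split_beta shift_def)
    then have "(\<Sum>d\<in>D. scale (p d) (fst (snd d))) = component c x"
      unfolding r using D by (simp add: sum.inter_filter)
    ultimately show "\<exists>p. (\<forall>d\<in>D. p d \<in> polys_in (snd (snd d))) \<and>
        (\<Sum>d\<in>D. scale (p d) (fst (snd d))) = component c x"
      by blast
  qed
  from choice[OF this] obtain p where p: "\<And>c d. d \<in> D \<Longrightarrow> p c d \<in> polys_in (snd (snd d))"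
      "\<And>c. (\<Sum>d\<in>D. scale (p c d) (fst (snd d))) = component c x"
    by blast
  have "(\<Sum>d\<in>D. scale (\<Sum>c\<in>support x. p c d) (fst (snd d))) =
      (\<Sum>c\<in>support x. \<Sum>d\<in>D. scale (p c d) (fst (snd d)))"
    unfolding scale_sum_left by (rule sum.swap)
  then have "(\<Sum>d\<in>D. scale (\<Sum>c\<in>support x. p c d) (fst (snd d))) = x"
    by (simp add: p(2) sum_component)
  then show ?thesis
    using p(1) by (intro exI[of _ "\<lambda>d. \<Sum>c\<in>support x. p c d"]) (auto intro: polys_in_sum)
qed

text \<open>Independence over polynomials gives freeness, from a relation with one term, and
  uniqueness, from the difference of two representations.\<close>

lemma stanley_decomposition_of_basis:
  assumes SB: "P.stanley_basis (\<lambda>_. {0}) comp D" and ds: "distinct ds" "set ds = D"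
  shows "stanley_decomposition (map snd ds)"
  unfolding stanley_decomposition_def
proof
  have D: "finite D" using SB by (simp add: P.stanley_basis_def)
  show "\<forall>(x, Z)\<in>set (map snd ds). homogeneous x \<and> (\<forall>p\<in>polys_in Z. p \<noteq> 0 \<longrightarrow> scale p x \<noteq> 0)"
  proof safe
    fix x Z assume "(x, Z) \<in> set (map snd ds)"
    then obtain a where d: "(a, x, Z) \<in> D" using ds by auto
    then show "homogeneous x" using stanley_basis_comp[OF SB] by (auto simp: homogeneous_def)
    show False if q: "q \<in> polys_in Z" "q \<noteq> 0" "scale q x = 0" for q
    proof -
      let ?p = "\<lambda>d. if d = (a, x, Z) then q else 0"
      have "(\<Sum>d\<in>D. scale (?p d) (fst (snd d))) = 0"
        using q(3) by (intro sum.neutral) auto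
      then have "?p (a, x, Z) = 0"
        using q(1) by (intro stanley_basis_independent[OF SB _ _ d]) (auto simp: polys_in_0)
      then show False using q(2) by simp
    qed
  qed
  let ?n = "length ds"
  define gen where "gen i = fst (snd (ds ! i))" for i
  define vars where "vars i = snd (snd (ds ! i))" for i
  have space: "stanley_space (map snd ds ! i) = {scale p (gen i) | p. p \<in> polys_in (vars i)}" if "i < ?n" for i
    using that by (simp add: stanley_space_def gen_def vars_def split_beta)
  have bij: "bij_betw ((!) ds) {..<?n} D" using bij_betw_nth[OF ds(1)] ds(2) by simp
  show "direct_sum {..<length (map snd ds)} (\<lambda>i. stanley_space (map snd ds ! i))"
    unfolding direct_sum_def
  proof (intro allI ex_ex1I)
    fix x
    obtain p where p: "\<And>d. d \<in> D \<Longrightarrow> p d \<in> polys_in (snd (snd d))"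
        "(\<Sum>d\<in>D. scale (p d) (fst (snd d))) = x"
      using stanley_basis_spans[OF SB] by blast
    define F where "F i = (if i < ?n then scale (p (ds ! i)) (gen i) else 0)" for i
    have "finite {i. F i \<noteq> 0}" by (rule finite_subset[of _ "{..<?n}"]) (auto simp: F_def)
    then have f: "Poly_Mapping.lookup (Abs_poly_mapping F) = F" by simp
    have keys: "Poly_Mapping.keys (Abs_poly_mapping F) \<subseteq> {..<?n}"
      by (auto simp: in_keys_iff f F_def split: if_splits)
    have "(\<Sum>i\<in>Poly_Mapping.keys (Abs_poly_mapping F). F i) = (\<Sum>i<?n. F i)"
      using keys by (intro sum.mono_neutral_left) (auto simp: in_keys_iff f)
    also have "\<dots> = (\<Sum>i<?n. scale (p (ds ! i)) (fst (snd (ds ! i))))"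
      by (simp add: F_def gen_def)
    also have "\<dots> = x" 
      using sum.reindex_bij_betw[OF bij, of "\<lambda>d. scale (p d) (fst (snd d))"] p(2) by simp
    finally have "x = (\<Sum>i\<in>Poly_Mapping.keys (Abs_poly_mapping F). F i)" by simp
    moreover have "F i \<in> stanley_space (map snd ds ! i)" if "i < ?n" for i
      using that p(1)[of "ds ! i"] ds(2) nth_mem[OF that] by (auto simp: space F_def vars_def simp del: nth_map)
    ultimately show "\<exists>f. Poly_Mapping.keys f \<subseteq> {..<length (map snd ds)} \<and>
        (\<forall>i\<in>{..<length (map snd ds)}. Poly_Mapping.lookup f i \<in> stanley_space (map snd ds ! i)) \<and>
        x = (\<Sum>i\<in>Poly_Mapping.keys f. Poly_Mapping.lookup f i)"
      using keys by (intro exI[of _ "Abs_poly_mapping F"]) (simp add: f)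
  next
    fix x and f g :: "nat \<Rightarrow>\<^sub>0 'm"
    let ?P = "\<lambda>f. Poly_Mapping.keys f \<subseteq> {..<length (map snd ds)} \<and>
        (\<forall>i\<in>{..<length (map snd ds)}. Poly_Mapping.lookup f i \<in> stanley_space (map snd ds ! i)) \<and>
        x = (\<Sum>i\<in>Poly_Mapping.keys f. Poly_Mapping.lookup f i)"
    assume fg: "?P f" "?P g"
    have coeffs: "\<exists>p. \<forall>i<?n. p i \<in> polys_in (vars i) \<and> Poly_Mapping.lookup f i = scale (p i) (gen i)"
      if f: "\<forall>i\<in>{..<length (map snd ds)}. Poly_Mapping.lookup f i \<in> stanley_space (map snd ds ! i)" for f
    proof -
      have "\<exists>p. p \<in> polys_in (vars i) \<and> Poly_Mapping.lookup f i = scale p (gen i)" if i: "i < ?n" for i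
        using bspec[OF f, of i] i unfolding space[OF i] by auto
      then have "\<forall>i\<in>{..<?n}. \<exists>p. p \<in> polys_in (vars i) \<and> Poly_Mapping.lookup f i = scale p (gen i)"
        by simp
      from bchoice[OF this] show ?thesis by auto
    qed
    obtain p where p: "\<And>i. i < ?n \<Longrightarrow> p i \<in> polys_in (vars i)"
        "\<And>i. i < ?n \<Longrightarrow> Poly_Mapping.lookup f i = scale (p i) (gen i)"
      using coeffs[OF fg(1)[THEN conjunct2, THEN conjunct1]] by blast
    obtain q where q: "\<And>i. i < ?n \<Longrightarrow> q i \<in> polys_in (vars i)"
        "\<And>i. i < ?n \<Longrightarrow> Poly_Mapping.lookup g i = scale (q i) (gen i)"
      using coeffs[OF fg(2)[THEN conjunct2, THEN conjunct1]] by blast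
    have sum: "(\<Sum>i<?n. Poly_Mapping.lookup f i) = x" if "?P f" for f
    proof -
      have "(\<Sum>i\<in>Poly_Mapping.keys f. Poly_Mapping.lookup f i) = (\<Sum>i<?n. Poly_Mapping.lookup f i)"
        using that by (intro sum.mono_neutral_left) (auto simp: in_keys_iff)
      then show ?thesis using that by simp
    qed
    \<comment> \<open>\<open>p\<close> and \<open>q\<close> are indexed by list positions,
      independence by triples; \<open>idx\<close> translates, as \<open>ds\<close> is
      distinct.\<close>
    define idx where "idx = the_inv_into {..<?n} ((!) ds)"
    have idx: "idx (ds ! i) = i" if "i < ?n" for i
      using that bij by (auto simp: idx_def bij_betw_def intro: the_inv_into_f_f)
    have "(\<Sum>d\<in>D. scale (p (idx d) - q (idx d)) (fst (snd d))) =
        (\<Sum>i<?n. scale (p i - q i) (gen i))"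
      unfolding sum.reindex_bij_betw[OF bij, symmetric] by (simp add: idx gen_def)
    also have "\<dots> = (\<Sum>i<?n. Poly_Mapping.lookup f i - Poly_Mapping.lookup g i)"
      by (simp add: p q scale_left_diff_distrib)
    also have "\<dots> = 0" using sum[OF fg(1)] sum[OF fg(2)] by (simp add: sum_subtractf)
    finally have *: "(\<Sum>d\<in>D. scale (p (idx d) - q (idx d)) (fst (snd d))) = 0" .
    have mem: "p (idx d) - q (idx d) \<in> polys_in (snd (snd d))" if "d \<in> D" for d
    proof -
      obtain i where "i < ?n" "d = ds ! i" using \<open>d \<in> D\<close> ds(2) by (auto simp: in_set_conv_nth)
      then show ?thesis using p q by (auto simp: idx vars_def intro: polys_in_diff)
    qed
    have "p i = q i" if "i < ?n" for i
      using stanley_basis_independent[OF SB mem *, of "ds ! i"] ds(2) that by (auto simp: idx)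
    moreover have "Poly_Mapping.lookup f i = 0" "Poly_Mapping.lookup g i = 0" if "\<not> i < ?n" for i
      using fg[THEN conjunct1] that by (auto simp: in_keys_iff subset_iff)
    ultimately have "Poly_Mapping.lookup f i = Poly_Mapping.lookup g i" for i
      using p q by (cases "i < ?n") auto
    then show "f = g" by (rule poly_mapping_eqI)
  qed
qed

lemma homogeneous_socle:
  assumes "P.torsion UNIV c \<noteq> {0}"
  shows "\<exists>b z. z \<in> comp b \<and> z \<noteq> 0 \<and> (\<forall>j. scale (Var j) z = 0)"
proof -
  obtain v where "v \<in> P.torsion UNIV c" "v \<noteq> 0"
    using assms K.subspace_0[OF P.subspace_torsion[of UNIV c]] by auto
  from P.torsion_UNIV_socle[OF this] show ?thesis unfolding shift_succ .
qed

lemma ex_stanley_decomposition: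
  "\<exists>D. stanley_decomposition D \<and>
    ((\<forall>x. (\<forall>j. scale (Var j) x = 0) \<longrightarrow> x = 0) \<longrightarrow> (\<forall>(m, Z)\<in>set D. Z \<noteq> {}))"
proof -
  obtain lo h where "stable_persistence_module scaleK comp shift lo h" using ex_stable by blast
  then interpret S: stable_persistence_module scaleK comp shift lo h .
  obtain D where D: "P.stanley_basis (\<lambda>_. {0}) comp D"
      "\<And>a m Z. (a, m, Z) \<in> D \<Longrightarrow> Z \<noteq> {} \<or> m \<in> P.torsion UNIV a"
    using S.ex_stanley_basis by blast
  obtain ds where ds: "distinct ds" "set ds = D"
    using finite_distinct_list[of D] D(1) by (auto simp: P.stanley_basis_def)
  have sd: "stanley_decomposition (map snd ds)"
    using stanley_decomposition_of_basis[OF D(1) ds] .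
  moreover have "Z \<noteq> {}"
    if socle: "\<forall>x. (\<forall>j. scale (Var j) x = 0) \<longrightarrow> x = 0" and mZ: "(m, Z) \<in> set (map snd ds)" for m Z
  proof -
    obtain a where a: "(a, m, Z) \<in> D" using mZ ds by auto
    \<comment> \<open>Freeness applied to the constant 1 makes \<open>m\<close> nonzero; were it
      torsion for all variables, there would be a socle element.\<close>
    have "1 \<in> polys_in Z" by (simp add: polys_in_def)
    then have "m \<noteq> 0" using sd mZ by (force simp: stanley_decomposition_def)
    then have "m \<notin> P.torsion UNIV a" using homogeneous_socle[of a] socle by blast
    then show ?thesis using D(2) a by blast
  qed
  ultimately show ?thesis by blast
qed

end

section \<open>Depth zero\<close>

lemma module_mult: "module ((*) :: 'a::comm_ring_1 \<Rightarrow> 'a \<Rightarrow> 'a)"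
  by unfold_locales (simp_all add: algebra_simps)

context module
begin

lemma mult_submodule_Nil: "mult_submodule scale [] = {0}"
  by (simp add: mult_submodule_def)

lemma mult_submodule_single: "mult_submodule scale [f] = range (scale f)"
proof -
  have "subspace (range (scale f))"
  proof (rule subspaceI)
    show "0 \<in> range (scale f)" by (metis scale_zero_right rangeI)
    show "x + y \<in> range (scale f)" if "x \<in> range (scale f)" "y \<in> range (scale f)" for x y
      using that by (auto simp flip: scale_right_distrib)
    show "scale c x \<in> range (scale f)" if "x \<in> range (scale f)" for c x
      using that by (auto simp: mult.commute[of c]) (metis rangeI scale_scale)
  qed
  then have "span (range (scale f)) = range (scale f)" by simp
  moreover have "{scale g x | g x. g \<in> set [f]} = range (scale f)" by auto
  ultimately show ?thesis unfolding mult_submodule_def by simp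
qed

lemma regular_sequence_single:
  "regular_sequence scale [f] \<longleftrightarrow> (\<forall>x. scale f x = 0 \<longrightarrow> x = 0) \<and> range (scale f) \<noteq> UNIV"
  by (simp add: regular_sequence_def mult_submodule_Nil mult_submodule_single)

lemma regular_sequence_Cons_regular:
  assumes "regular_sequence scale (f # fs)" "scale f x = 0"
  shows "x = 0"
proof -
  have "\<forall>i<length (f # fs). \<forall>x. scale ((f # fs) ! i) x \<in> mult_submodule scale (take i (f # fs)) \<longrightarrow>
      x \<in> mult_submodule scale (take i (f # fs))"
    using assms(1) unfolding regular_sequence_def by (rule conjunct1)
  from this[rule_format, of 0 x] show ?thesis using assms(2) by (simp add: mult_submodule_Nil)
qed

end

lemma depth_eq_0_iff:
  "depth scale I = 0 \<longleftrightarrow> (\<forall>fs. set fs \<subseteq> I \<longrightarrow> regular_sequence scale fs \<longrightarrow> fs = [])"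
  unfolding depth_def bot_enat_def[symmetric] SUP_bot_conv by (auto simp: bot_enat_def enat_0_iff)

context multigraded_module
begin

lemma irrelevant_ideal_annihilates:
  assumes "\<And>j. scale (Var j) x = 0" "f \<in> irrelevant_ideal"
  shows "scale f x = 0"
proof -
  interpret R: module "(*) :: ('k, 'n) polyring \<Rightarrow> _" by (rule module_mult)
  have "R.subspace {f. scale f x = 0}"
    by (rule R.subspaceI) (simp_all add: scale_left_distrib flip: scale_scale)
  then have "R.span (range Var) \<subseteq> {f. scale f x = 0}"
    using assms(1) by (intro R.span_minimal) auto
  then show ?thesis using assms(2) by (auto simp: irrelevant_ideal_def)
qed

text \<open>The first entry of a regular sequence is a nonzerodivisor, but everything in the
  irrelevant ideal kills \<open>x\<close>.\<close>

lemma depth_zero_of_socle: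
  assumes "\<And>j. scale (Var j) x = 0" "x \<noteq> 0"
  shows "depth scale irrelevant_ideal = 0"
  unfolding depth_eq_0_iff
proof (intro allI impI)
  fix fs assume fs: "set fs \<subseteq> irrelevant_ideal" "regular_sequence scale fs"
  show "fs = []"
  proof (cases fs)
    case (Cons f gs)
    then have "scale f x = 0" using fs irrelevant_ideal_annihilates[OF assms(1)] by simp
    then show ?thesis using regular_sequence_Cons_regular fs(2) Cons assms(2) by blast
  qed
qed

end

section \<open>The sum of the variables as a nonzerodivisor\<close>

context fg_multigraded_module
begin

lemma shift_pred: "shift (c(j := c j - 1)) c x = scale (Var j) x"
  using shift_succ[of "c(j := c j - 1)" j x] by simp

lemma component_scale_sum_Var:
  "component c (scale (\<Sum>j\<in>UNIV. Var j) x) = (\<Sum>j\<in>UNIV. scale (Var j) (component (c(j := c j - 1)) x))"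
  by (simp add: scale_sum_left component_sum component_scale_Var)

text \<open>In the leading coefficient of \<open>y\<close> with respect to the degree in \<open>x\<^sub>j\<close>, only the summand
  \<open>x\<^sub>j\<close> of \<open>\<Sum>\<^sub>i x\<^sub>i\<close> is visible, so it is killed by \<open>x\<^sub>j\<close>; then descend.\<close>

lemma torsion_of_sum_Var_zero:
  assumes y: "scale (\<Sum>j\<in>UNIV. Var j) y = 0"
  shows "component c y \<in> P.torsion UNIV c"
proof -
  have "component b y \<in> P.torsion {j} b" for b j
  proof (rule ccontr)
    let ?bad = "{b \<in> support y. component b y \<notin> P.torsion {j} b}"
    assume "component b y \<notin> P.torsion {j} b"
    moreover from this have "b \<in> support y"
      using K.subspace_0[OF P.subspace_torsion, of "{j}" b] by (auto simp: support_def)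
    ultimately have ne: "?bad \<noteq> {}" by blast
    have fin: "finite ?bad" using finite_support by simp
    define t where "t = Max ((\<lambda>b. b j) ` ?bad)"
    have "t \<in> (\<lambda>b. b j) ` ?bad" unfolding t_def using ne fin by (intro Max_in) auto
    then obtain b where b: "b \<in> ?bad" "b j = t" by blast
    have max: "component b' y \<in> P.torsion {j} b'" if "b' j > t" for b'
    proof (rule ccontr)
      assume *: "component b' y \<notin> P.torsion {j} b'"
      moreover from * have "b' \<in> support y"
        using K.subspace_0[OF P.subspace_torsion, of "{j}" b'] by (auto simp: support_def)
      ultimately have "b' j \<le> t" unfolding t_def using fin by (intro Max_ge) auto
      then show False using that by simp
    qed
    \<comment> \<open>In this degree the equation expresses x_j times the component at
      \<open>b\<close> by components of \<open>j\<close>-degree \<open>t + 1\<close>, which are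
      x_j-torsion by the choice of \<open>t\<close>.\<close>
    let ?b = "b(j := b j + 1)"
    have le: "?b(i := ?b i - 1) \<le> ?b" for i by (auto simp: le_fun_def)
    have Var: "scale (Var i) x = shift (?b(i := ?b i - 1)) ?b x" for i x
      by (rule shift_pred[symmetric])
    have "0 = (\<Sum>i\<in>UNIV. scale (Var i) (component (?b(i := ?b i - 1)) y))"
      using component_scale_sum_Var[of ?b y] y by simp
    also have "\<dots> = scale (Var j) (component b y) +
        (\<Sum>i\<in>UNIV - {j}. scale (Var i) (component (?b(i := ?b i - 1)) y))"
      by (subst sum.remove[of _ j]) auto
    finally have "shift b ?b (component b y) =
        - (\<Sum>i\<in>UNIV - {j}. scale (Var i) (component (?b(i := ?b i - 1)) y))"
      by (simp add: shift_succ eq_neg_iff_add_eq_0)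
    also have "\<dots> \<in> P.torsion {j} ?b"
    proof (intro K.subspace_neg K.subspace_sum P.subspace_torsion)
      fix i assume "i \<in> UNIV - {j}"
      then have "component (?b(i := ?b i - 1)) y \<in> P.torsion {j} (?b(i := ?b i - 1))"
        using b(2) by (intro max) auto
      then show "scale (Var i) (component (?b(i := ?b i - 1)) y) \<in> P.torsion {j} ?b"
        unfolding Var by (intro P.T_torsion le)
    qed
    finally have "component b y \<in> P.torsion {j} b"
      using P.torsion_regular[of "component b y" "{}" b j "b j + 1"] component_in by simp
    then show False using b by simp
  qed
  then show ?thesis by (auto simp: P.torsion_def)
qed

text \<open>Graded Nakayama: a nonzero element of a component of least total degree is no multiple
  of the linear form, as it would come from components of smaller total degree. The bound
  \<open>lo\<close> provides a least one.\<close>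

lemma range_scale_sum_Var:
  assumes "(UNIV :: 'm set) \<noteq> {0}"
  shows "range (scale (\<Sum>j\<in>UNIV. Var j)) \<noteq> UNIV"
proof
  assume surj: "range (scale (\<Sum>j\<in>UNIV. Var j)) = UNIV"
  obtain lo h where "stable_persistence_module scaleK comp shift lo h" using ex_stable by blast
  then interpret S: stable_persistence_module scaleK comp shift lo h .
  obtain x :: 'm where "x \<noteq> 0" using assms by blast
  then have "support x \<noteq> {}" using sum_component[of x] by auto
  then obtain a0 where a0: "component a0 x \<noteq> 0" by (auto simp: support_def)
  let ?P = "\<lambda>a. comp a \<noteq> {0}" and ?w = "\<lambda>a. nat (\<Sum>j\<in>UNIV. a j - lo)"
  have P: "?P a" if "component a z \<noteq> 0" for a z using that component_in[of a z] by auto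
  obtain a where a: "?P a" "\<And>b. ?P b \<Longrightarrow> ?w a \<le> ?w b"
    using ex_has_least_nat[of ?P a0 ?w] P[OF a0] by blast
  have lo: "lo \<le> a j" for j using S.V_below[of a j] a(1) by force
  obtain z where z: "z \<in> comp a" "z \<noteq> 0" using a(1) zero_closed by blast
  obtain y where y: "z = scale (\<Sum>j\<in>UNIV. Var j) y" using surj by (metis UNIV_I imageE)
  have "component (a(j := a j - 1)) y = 0" for j
  proof (rule ccontr)
    let ?a = "a(j := a j - 1)"
    assume "component ?a y \<noteq> 0"
    then have "?w a \<le> ?w ?a" by (intro a(2) P)
    moreover have "(\<Sum>i\<in>UNIV. ?a i - lo) < (\<Sum>i\<in>UNIV. a i - lo)"
      by (intro sum_strict_mono_ex1) auto
    moreover have "lo \<le> ?a i" for i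
      using S.V_below[of ?a i] P[OF \<open>component ?a y \<noteq> 0\<close>] by force
    then have "0 \<le> (\<Sum>i\<in>UNIV. ?a i - lo)" by (intro sum_nonneg) simp
    ultimately show False by linarith
  qed
  then have "component a z = 0" unfolding y component_scale_sum_Var by simp
  then show False using z component_homogeneous[OF z(1), of a] by simp
qed

lemma socle_of_depth_zero:
  assumes M: "(UNIV :: 'm set) \<noteq> {0}" and depth: "depth scale irrelevant_ideal = 0"
  shows "\<exists>a z. z \<in> comp a \<and> z \<noteq> 0 \<and> (\<forall>j. scale (Var j) z = 0)"
proof (rule ccontr)
  assume none: "\<not> ?thesis"
  interpret R: module "(*) :: ('k, 'n) polyring \<Rightarrow> _" by (rule module_mult)
  let ?f = "\<Sum>j\<in>UNIV. Var j :: ('k, 'n) polyring"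
  have "?f \<in> irrelevant_ideal"
    unfolding irrelevant_ideal_def by (intro R.span_sum R.span_base) auto
  moreover have "y = 0" if "scale ?f y = 0" for y
  proof -
    have "P.torsion UNIV c = {0}" for c using homogeneous_socle[of c] none by blast
    then have "component c y = 0" for c using torsion_of_sum_Var_zero[OF that, of c] by simp
    then show ?thesis using sum_component[of y] by simp
  qed
  then have "regular_sequence scale [?f]"
    using range_scale_sum_Var[OF M] by (simp add: regular_sequence_single)
  ultimately show False using depth unfolding depth_eq_0_iff by force
qed

section \<open>Stanley depth zero\<close>

lemma stanley_decomposition_nonempty:
  assumes "(UNIV :: 'm set) \<noteq> {0}" "stanley_decomposition D"
  shows "D \<noteq> []"
proof
  assume "D = []"
  then have "x = 0" for x :: 'm
    using assms(2) by (auto simp: stanley_decomposition_def direct_sum_def)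
  then show False using assms(1) by auto
qed

lemma finite_sdepths:
  assumes "(UNIV :: 'm set) \<noteq> {0}"
  shows "finite {sdepth_of D | D. stanley_decomposition D}"
proof -
  have "sdepth_of D \<le> card (UNIV :: 'n set)" if D: "stanley_decomposition D" for D
  proof -
    obtain d where "d \<in> set D" using stanley_decomposition_nonempty[OF assms D] by (cases D) auto
    then have "sdepth_of D \<le> card (snd d)" unfolding sdepth_of_def by (intro Min_le) (auto simp: split_beta)
    also have "\<dots> \<le> card (UNIV :: 'n set)" by (intro card_mono) auto
    finally show ?thesis .
  qed
  then have "{sdepth_of D | D. stanley_decomposition D} \<subseteq> {..card (UNIV :: 'n set)}" by blast
  then show ?thesis by (rule finite_subset) simp
qed

lemma proportional_of_dim_le_1:
  assumes dim: "dim_comp a \<le> 1" and xy: "x \<in> comp a" "y \<in> comp a" "y \<noteq> 0"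
  shows "\<exists>t. x = scaleK t y"
proof -
  obtain W where W: "finite W" "comp a \<subseteq> K.span W" using P.finite_dim by blast
  have "K.independent {y}" using xy(3) by (simp add: K.dependent_single)
  then obtain B where B: "{y} \<subseteq> B" "B \<subseteq> comp a" "K.independent B" "comp a \<subseteq> K.span B"
    using K.maximal_independent_subset_extend[of "{y}" "comp a"] xy(2) by auto
  \<comment> \<open>Needed first: an infinite \<open>B\<close> would have cardinality 0.\<close>
  have "finite B" using K.independent_span_bound[OF W(1) B(3)] B(2) W(2) by blast
  moreover have "card B \<le> 1"
    using dim K.basis_card_eq_dim[OF B(2) B(4) B(3)] by (simp add: dim_comp_def)
  ultimately have "B = {y}" using B(1) by (intro card_seteq[symmetric]) auto
  then have "x \<in> K.span {y}" using xy(1) B(4) by blast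
  then show ?thesis by (auto simp: K.span_singleton)
qed

lemma sdepth_of_zero_of_socle:
  assumes D: "stanley_decomposition D"
    and x: "x \<in> comp a" "x \<noteq> 0" "\<And>j. scale (Var j) x = 0"
    and dim: "dim_comp a \<le> 1"
  shows "sdepth_of D = 0"
proof -
  obtain f :: "nat \<Rightarrow>\<^sub>0 'm" where f: "Poly_Mapping.keys f \<subseteq> {..<length D}"
      "\<And>i. i < length D \<Longrightarrow> Poly_Mapping.lookup f i \<in> stanley_space (D ! i)"
      "x = (\<Sum>i\<in>Poly_Mapping.keys f. Poly_Mapping.lookup f i)"
    using D unfolding stanley_decomposition_def direct_sum_def by blast
  have "component a x \<noteq> 0" using component_homogeneous[OF x(1), of a] x(2) by simp
  \<comment> \<open>The summands of \<open>x\<close> need not be homogeneous, but one of them has a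
    nonzero part in degree \<open>a\<close>.\<close>
  then have "(\<Sum>i\<in>Poly_Mapping.keys f. component a (Poly_Mapping.lookup f i)) \<noteq> 0"
    by (subst (asm) f(3)) (simp add: component_sum)
  then obtain i where i: "i \<in> Poly_Mapping.keys f" "component a (Poly_Mapping.lookup f i) \<noteq> 0"
    by (meson sum.neutral)
  obtain m Z where mZ: "D ! i = (m, Z)" by (cases "D ! i")
  have len: "i < length D" using i(1) f(1) by auto
  then have mem: "(m, Z) \<in> set D" using mZ nth_mem by metis
  then obtain b where m: "m \<in> comp b" using D by (auto simp: stanley_decomposition_def homogeneous_def)
  have free: "scale p m \<noteq> 0" if "p \<in> polys_in Z" "p \<noteq> 0" for p
    using D mem that by (auto simp: stanley_decomposition_def)
  obtain p where p: "p \<in> polys_in Z" "Poly_Mapping.lookup f i = scale p m"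
    using f(2)[OF len] by (auto simp: mZ stanley_space_def)
  define u where "u = expdiff b a"
  have ba: "b \<le> a" and coeff: "Poly_Mapping.lookup p u \<noteq> 0"
    using i(2) by (auto simp: p(2) component_scale_homogeneous[OF m] u_def split: if_splits)
  then have u: "Poly_Mapping.keys u \<subseteq> Z" using p(1) by (auto simp: polys_in_iff)
  have nonzero: "Poly_Mapping.single v (1 :: 'k) \<noteq> 0" for v :: "'n \<Rightarrow>\<^sub>0 nat"
    by (metis lookup_single_eq lookup_zero zero_neq_one)
  have "scale (Poly_Mapping.single u 1) m \<noteq> 0"
    using u by (intro free polys_in_single nonzero)
  then obtain t where t: "x = scaleK t (scale (Poly_Mapping.single u 1) m)"
    using proportional_of_dim_le_1[OF dim x(1)] shift_in[OF ba m] by (auto simp: shift_def u_def)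
  have "Z = {}"
  proof (rule ccontr)
    assume "Z \<noteq> {}"
    then obtain j where j: "j \<in> Z" by blast
    \<comment> \<open>By freeness x_j x^u m is nonzero, yet \<open>t\<close> times it is x_j x =
      0.\<close>
    let ?v = "Poly_Mapping.single j 1 + u"
    have "Poly_Mapping.keys ?v \<subseteq> Z" using u j keys_add[of "Poly_Mapping.single j (1::nat)" u] by auto
    then have "scale (Poly_Mapping.single ?v 1) m \<noteq> 0"
      by (intro free polys_in_single nonzero)
    moreover have "scale (Var j) x = scaleK t (scale (Poly_Mapping.single ?v 1) m)"
      by (simp add: t scaleK_def Const_def Var_def mult_single add.commute)
    moreover have "t \<noteq> 0" using x(2) t by (auto simp: K.scale_zero_left)
    ultimately show False using x(3)[of j] by simp
  qed
  then have "0 \<in> (\<lambda>(x, Z). card Z) ` set D" using mem by force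
  then show ?thesis unfolding sdepth_of_def using Min_le[of "(\<lambda>(x, Z). card Z) ` set D" 0] by simp
qed

end

theorem theorem1p4:
  fixes scale :: "('k::field, 'n::finite) polyring \<Rightarrow> 'm::ab_group_add \<Rightarrow> 'm"
    and comp :: "('n \<Rightarrow> int) \<Rightarrow> 'm set"
  assumes "multigraded_module scale comp"
    and "finitely_generated scale"
    and "(UNIV :: 'm set) \<noteq> {0}"
  shows "(multigraded_module.sdepth scale comp = 0 \<longrightarrow>
            depth scale irrelevant_ideal = 0) \<and>
         (depth scale irrelevant_ideal = 0 \<and>
            (\<forall>a. multigraded_module.dim_comp scale comp a \<le> 1) \<longrightarrow>
            multigraded_module.sdepth scale comp = 0)"
proof -
  interpret fg_multigraded_module scale comp
    using assms(1,2) by (intro fg_multigraded_module.intro fg_multigraded_module_axioms.intro)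
  obtain D where D: "stanley_decomposition D"
      "(\<forall>x. (\<forall>j. scale (Var j) x = 0) \<longrightarrow> x = 0) \<Longrightarrow> (\<forall>(m, Z)\<in>set D. Z \<noteq> {})"
    using ex_stanley_decomposition by blast
  note fin = finite_sdepths[OF assms(3)]
  show ?thesis
  proof (intro conjI impI)
    assume sdepth: "sdepth = 0"
    show "depth scale irrelevant_ideal = 0"
    proof (rule ccontr)
      assume "depth scale irrelevant_ideal \<noteq> 0"
      then have "\<forall>x. (\<forall>j. scale (Var j) x = 0) \<longrightarrow> x = 0" using depth_zero_of_socle by blast
      then have "\<forall>(m, Z)\<in>set D. 0 < card Z" using D(2) by (auto simp: card_gt_0_iff)
      moreover have "sdepth_of D \<in> (\<lambda>(x, Z). card Z) ` set D"
        unfolding sdepth_of_def using stanley_decomposition_nonempty[OF assms(3) D(1)]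
        by (intro Min_in) auto
      ultimately have "0 < sdepth_of D" by auto
      also have "sdepth_of D \<le> sdepth" unfolding sdepth_def using fin D(1) by (intro Max_ge) auto
      finally show False using sdepth by simp
    qed
  next
    assume "depth scale irrelevant_ideal = 0 \<and> (\<forall>a. dim_comp a \<le> 1)"
    then obtain a z where z: "z \<in> comp a" "z \<noteq> 0" "\<And>j. scale (Var j) z = 0" "dim_comp a \<le> 1"
      using socle_of_depth_zero[OF assms(3)] by blast
    \<comment> \<open>\<open>D\<close> shows that the set is nonempty, so that its
      \<open>Max\<close> is meaningful.\<close>
    have "{sdepth_of D | D. stanley_decomposition D} = {0}"
      using sdepth_of_zero_of_socle[OF _ z] D(1) by (auto intro: exI[of _ D])
    then show "sdepth = 0" by (simp add: sdepth_def)
  qed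
qed

end
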